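(* Let $\mathbb{K}$ be a field of characteristic zero and let $P(t,x,y,z)\in\mathbb{K}[t,x,y,z]$ be a polynomial in the single variables $t,x,y,z$. Suppose that the equation $P(t,x,y,z)=0$ has a nested formal power series solution $(\widehat{y}(t),\widehat{z}(t,x))$, i.e. $\widehat{y}(t)\in\mathbb{K}[[t]]$, $\widehat{z}(t,x)\in\mathbb{K}[[t,x]]$ and $$P(t,x,\widehat{y}(t),\widehat{z}(t,x))=0.$$ Assume that $$\frac{\partial P}{\partial z}(t,x,\widehat{y}(t),\widehat{z}(t,x))\not\equiv 0 \bmod (t),$$ i.e. this power series has a monomial (with nonzero coefficient) not depending on the variable $t$. Then there exists a nested algebraic power series solution $(y(t),z(t,x))$, i.e. $y(t)\in\mathbb{K}\langle t\rangle$ and $z(t,x)\in\mathbb{K}\langle t,x\rangle$ with $$P(t,x,y(t),z(t,x))=0.$$ In particular, if $(\widehat{y}(t),\widehat{z}(t,x))$ is the unique nested formal power series solution of $P=0$, then it is already algebraic, i.e. $\widehat{y}(t)\in\mathbb{K}\langle t\rangle$ and $\widehat{z}(t,x)\in\mathbb{K}\langle t,x\rangle$.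
   Context: For variables $x=(x_1,\ldots,x_n)$, $\mathbb{K}\langle x\rangle$ denotes the ring of algebraic power series over $\mathbb{K}$: those formal power series $f\in\mathbb{K}[[x]]$ for which there is a nonzero polynomial $R(x,w)\in\mathbb{K}[x,w]$ ($w$ a single variable) with $R(x,f(x))=0$. "Nested" means that the first component of the solution depends only on $t$, while the second may depend on both $t$ and $x$. The ideal $(t)$ is the ideal of $\mathbb{K}[[t,x]]$ generated by $t$. *)

theory Defs
  imports "HOL-Computational_Algebra.Computational_Algebra"
begin

(* Multivariate rings are iterated univariate ones, with t innermost:
     K[t,x] is 'a poly poly,  K[t,x,y,z] is 'a poly poly poly poly  (z outermost);
     K[[t]] is 'a fps,  K[[t,x]] = K[[t]][[x]] is 'a fps fps.
   Hence K[[t]] embeds in K[[t,x]] by fps_const, and inside K[[t,x]] the variable t is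
   fps_const fps_X while x is fps_X. *)

definition fps2_of_poly2 :: "'a::comm_ring_1 poly poly \<Rightarrow> 'a fps fps" where
  "fps2_of_poly2 q = fps_of_poly (map_poly fps_of_poly q)"

(* P(t, x, y(t), z(t,x)) *)
definition subst_nested ::
    "'a::comm_ring_1 poly poly poly poly \<Rightarrow> 'a fps \<Rightarrow> 'a fps fps \<Rightarrow> 'a fps fps" where
  "subst_nested P y z =
     poly (map_poly (\<lambda>Q. poly (map_poly fps2_of_poly2 Q) (fps_const y)) P) z"

definition nested_solution ::
    "'a::comm_ring_1 poly poly poly poly \<Rightarrow> 'a fps \<Rightarrow> 'a fps fps \<Rightarrow> bool" where
  "nested_solution P y z \<longleftrightarrow> subst_nested P y z = 0"

(* In the next two definitions the outermost variable of R is w. *)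

definition algebraic_fps :: "'a::comm_ring_1 fps \<Rightarrow> bool" where
  "algebraic_fps f \<longleftrightarrow>
     (\<exists>R :: 'a poly poly. R \<noteq> 0 \<and> poly (map_poly fps_of_poly R) f = 0)"

definition algebraic_fps2 :: "'a::comm_ring_1 fps fps \<Rightarrow> bool" where
  "algebraic_fps2 f \<longleftrightarrow>
     (\<exists>R :: 'a poly poly poly. R \<noteq> 0 \<and> poly (map_poly fps2_of_poly2 R) f = 0)"

end

theory Submission
  imports Defs
begin

text \<open>
  The equation is solved by specialising the coefficients of a formal solution. Fix a subring \<open>A\<close>
  of \<open>K[[t]]\<close> that is generated over \<open>K[t]\<close> by finitely many series. Then for every \<open>c\<close> there is a
  homomorphism over \<open>K[t]\<close> from \<open>A\<close> to \<open>K\<langle>t\<rangle>\<close> that changes no element of \<open>A\<close> modulo \<open>t\<^sup>c\<close>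
  (\<open>ex_specialization\<close>). This is Artin approximation in one variable, and it is proved one generator
  \<open>u\<close> at a time: a transcendental \<open>u\<close> may be sent to any polynomial close to it, and an algebraic
  \<open>u\<close> is sent to the root near \<open>u\<close> of its specialised minimal equation. That root exists by
  Newton's method, because the equation is separable in characteristic zero. It is an algebraic
  series because elements algebraic over algebraic ones are algebraic (\<open>algebraic_root\<close>).

  It remains to encode the solution of the given equation in finitely many elements of \<open>K[[t]]\<close>,
  by an argument in the style of Tougeron's implicit function theorem. The hypothesis on
  \<open>\<partial>P/\<partial>z\<close> says that its value at the formal solution is regular in \<open>x\<close>, so by Weierstrass
  preparation it is a unit times a monic polynomial \<open>a \<in> K[[t]][x]\<close>. Let \<open>z\<^sub>0 \<in> K[[t]][x]\<close> be the
  remainder of the second component of the formal solution on Weierstrass division by \<open>x a\<^sup>2\<close>. Taylor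
  expansion gives
  \<open>P(t,x,y,z\<^sub>0) = x a\<^sup>2 G\<close> and \<open>\<partial>P/\<partial>z(t,x,y,z\<^sub>0) = a V\<close> with \<open>V(0,0) \<noteq> 0\<close>, and \<open>G\<close> and \<open>V\<close> are again
  polynomials in \<open>x\<close> (\<open>ex_tougeron_data\<close>). These are polynomial identities between \<open>y\<close> and the
  coefficients of \<open>z\<^sub>0\<close>, \<open>a\<close>, \<open>G\<close>, \<open>V\<close>, so a specialisation transports them to algebraic
  series, and modulo \<open>t\<close> it keeps \<open>V(0,0)\<close>. From the specialised identities Hensel's lemma
  produces a solution \<open>z = z\<^sub>0 + a x w\<close> (\<open>nested_solution_of_tougeron_data\<close>). It is a root of
  \<open>P(t,x,y,Z)\<close>, which is a nonzero polynomial in \<open>Z\<close> with algebraic coefficients; hence \<open>z\<close> is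
  algebraic. The first component depends on \<open>t\<close> only and is just one more coefficient to be
  specialised, so the nested condition holds by construction.
\<close>

section \<open>Ring homomorphisms defined on a subring\<close>

text \<open>The specialisations used below are defined only on a finitely generated subring of
  \<open>K[[t]]\<close> and need not extend to the whole ring. So the standard facts on
  coefficientwise application of a homomorphism are developed relative to a subring; total
  homomorphisms are the case \<open>UNIV\<close>.\<close>

locale subring =
  fixes A :: "'r::idom set"
  assumes one_mem [simp]: "1 \<in> A"
    and minus_mem [simp]: "a \<in> A \<Longrightarrow> b \<in> A \<Longrightarrow> a - b \<in> A"
    and mult_mem [simp]: "a \<in> A \<Longrightarrow> b \<in> A \<Longrightarrow> a * b \<in> A"
begin

lemma zero_mem [simp]: "0 \<in> A"
  using minus_mem[OF one_mem one_mem] by simp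

lemma uminus_mem [simp]: "a \<in> A \<Longrightarrow> - a \<in> A"
  using minus_mem[OF zero_mem, of a] by simp

lemma add_mem [simp]: "a \<in> A \<Longrightarrow> b \<in> A \<Longrightarrow> a + b \<in> A"
  using minus_mem[of a "- b"] by simp

lemma of_nat_mem [simp]: "of_nat n \<in> A"
  by (induction n) simp_all

lemma power_mem [simp]: "a \<in> A \<Longrightarrow> a ^ n \<in> A"
  by (induction n) simp_all

lemma sum_mem: "(\<And>i. i \<in> I \<Longrightarrow> f i \<in> A) \<Longrightarrow> sum f I \<in> A"
  by (induction I rule: infinite_finite_induct) simp_all

end

locale subring_hom = subring A for A :: "'r::idom set" +
  fixes h :: "'r \<Rightarrow> 's::idom"
  assumes hom_one [simp]: "h 1 = 1"
    and hom_minus: "a \<in> A \<Longrightarrow> b \<in> A \<Longrightarrow> h (a - b) = h a - h b"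
    and hom_mult: "a \<in> A \<Longrightarrow> b \<in> A \<Longrightarrow> h (a * b) = h a * h b"
begin

lemma hom_zero [simp]: "h 0 = 0"
  using hom_minus[OF one_mem one_mem] by simp

lemma hom_uminus: "a \<in> A \<Longrightarrow> h (- a) = - h a"
  using hom_minus[OF zero_mem, of a] by simp

lemma hom_add: "a \<in> A \<Longrightarrow> b \<in> A \<Longrightarrow> h (a + b) = h a + h b"
  using hom_minus[of a "- b"] by (simp add: hom_uminus)

lemma hom_of_nat [simp]: "h (of_nat n) = of_nat n"
  by (induction n) (simp_all add: hom_add)

lemma hom_power: "a \<in> A \<Longrightarrow> h (a ^ n) = h a ^ n"
  by (induction n) (simp_all add: hom_mult)

lemma hom_sum: "(\<And>i. i \<in> I \<Longrightarrow> f i \<in> A) \<Longrightarrow> h (sum f I) = (\<Sum>i\<in>I. h (f i))"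
  by (induction I rule: infinite_finite_induct) (simp_all add: hom_add sum_mem)

end

definition coeffs_in :: "'r::zero set \<Rightarrow> 'r poly set" where
  "coeffs_in A = {p. \<forall>i. coeff p i \<in> A}"

lemma coeffs_inD: "p \<in> coeffs_in A \<Longrightarrow> coeff p i \<in> A"
  by (simp add: coeffs_in_def)

lemma coeffs_in_UNIV [simp]: "coeffs_in UNIV = UNIV"
  by (simp add: coeffs_in_def)

context subring
begin

lemma pCons_mem: "pCons a p \<in> coeffs_in A \<longleftrightarrow> a \<in> A \<and> p \<in> coeffs_in A"
proof -
  have "(\<forall>i. coeff (pCons a p) i \<in> A) \<longleftrightarrow> a \<in> A \<and> (\<forall>i. coeff p i \<in> A)"
    by (metis coeff_pCons_0 coeff_pCons_Suc not0_implies_Suc)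
  thus ?thesis by (simp add: coeffs_in_def)
qed

lemma zero_poly_mem [simp]: "0 \<in> coeffs_in A"
  by (simp add: coeffs_in_def)

lemma subring_coeffs_in: "subring (coeffs_in A)"
proof
  show "1 \<in> coeffs_in A"
    by (simp add: coeffs_in_def coeff_1)
  fix p q assume pq: "p \<in> coeffs_in A" "q \<in> coeffs_in A"
  hence c: "coeff p i \<in> A" "coeff q i \<in> A" for i
    by (auto dest: coeffs_inD)
  show "p - q \<in> coeffs_in A"
    using c by (simp add: coeffs_in_def)
  show "p * q \<in> coeffs_in A"
    using c by (auto simp: coeffs_in_def coeff_mult intro!: sum_mem)
qed

lemma poly_mem:
  assumes "p \<in> coeffs_in A" "x \<in> A" shows "poly p x \<in> A"
  using assms(1)
  by (induction p) (use assms(2) in \<open>auto simp: pCons_mem\<close>)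

lemma pderiv_mem: "p \<in> coeffs_in A \<Longrightarrow> pderiv p \<in> coeffs_in A"
  by (auto simp: coeffs_in_def coeff_pderiv simp del: of_nat_Suc)

lemma smult_mem: "a \<in> A \<Longrightarrow> p \<in> coeffs_in A \<Longrightarrow> smult a p \<in> coeffs_in A"
  by (auto simp: coeffs_in_def)

lemma monom_mem: "a \<in> A \<Longrightarrow> monom a n \<in> coeffs_in A"
  by (auto simp: coeffs_in_def)

end

context subring_hom
begin

lemma map_poly_hom: "subring_hom (coeffs_in A) (map_poly h)"
proof (intro subring_hom.intro subring_coeffs_in subring_hom_axioms.intro)
  show "map_poly h 1 = 1"
    by simp
  fix p q assume pq: "p \<in> coeffs_in A" "q \<in> coeffs_in A"
  hence c: "coeff p i \<in> A" "coeff q i \<in> A" for i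
    by (auto dest: coeffs_inD)
  show "map_poly h (p - q) = map_poly h p - map_poly h q"
    using c by (intro poly_eqI) (simp add: coeff_map_poly hom_minus)
  show "map_poly h (p * q) = map_poly h p * map_poly h q"
    using c by (intro poly_eqI) (simp add: coeff_map_poly coeff_mult hom_sum hom_mult)
qed

lemma hom_poly:
  assumes "p \<in> coeffs_in A" "x \<in> A"
  shows "h (poly p x) = poly (map_poly h p) (h x)"
  using assms(1)
proof (induction p)
  case (pCons a p)
  thus ?case
    using assms(2) by (simp add: pCons_mem map_poly_pCons hom_add hom_mult poly_mem)
qed simp

lemma map_poly_pderiv:
  "p \<in> coeffs_in A \<Longrightarrow> map_poly h (pderiv p) = pderiv (map_poly h p)"
  by (intro poly_eqI)
     (simp add: coeff_map_poly coeff_pderiv hom_mult coeffs_inD del: of_nat_Suc)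

lemma map_poly_hom_smult:
  "a \<in> A \<Longrightarrow> p \<in> coeffs_in A \<Longrightarrow> map_poly h (smult a p) = smult (h a) (map_poly h p)"
  by (intro poly_eqI) (simp add: coeff_map_poly hom_mult coeffs_inD)

lemma eval_hom:
  shows "subring_hom (coeffs_in A) (\<lambda>Q. poly (map_poly h Q) c)"
proof -
  interpret map_poly: subring_hom "coeffs_in A" "map_poly h" by (rule map_poly_hom)
  show ?thesis by standard (simp_all add: map_poly.hom_minus map_poly.hom_mult)
qed

end

lemma subring_hom_comp:
  assumes "subring_hom UNIV g" "subring_hom UNIV h"
  shows "subring_hom UNIV (\<lambda>x. g (h x))"
proof -
  interpret g: subring_hom UNIV g by fact
  interpret h: subring_hom UNIV h by fact
  show ?thesis
    by standard (simp_all add: g.hom_minus g.hom_mult h.hom_minus h.hom_mult)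
qed

lemma subring_hom_fps_of_poly: "subring_hom UNIV (fps_of_poly :: 'a::idom poly \<Rightarrow> 'a fps)"
  by standard (simp_all add: fps_of_poly_diff fps_of_poly_mult)

lemma subring_hom_fps_const: "subring_hom UNIV (fps_const :: 'a::idom \<Rightarrow> 'a fps)"
  by standard simp_all

lemma subring_hom_map_poly: "subring_hom UNIV h \<Longrightarrow> subring_hom UNIV (map_poly h)"
proof -
  assume "subring_hom UNIV h"
  then interpret subring_hom UNIV h .
  show ?thesis using map_poly_hom by simp
qed

lemma subring_hom_fps2_of_poly2:
  "subring_hom UNIV (fps2_of_poly2 :: 'a::idom poly poly \<Rightarrow> 'a fps fps)"
  unfolding fps2_of_poly2_def
  by (rule subring_hom_comp[OF subring_hom_fps_of_poly
        subring_hom_map_poly[OF subring_hom_fps_of_poly]])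

section \<open>Completeness and contractions\<close>

text \<open>Complete and separated; Cauchy sequences are normalised so that step \<open>n\<close> is divisible by
  \<open>p\<^sup>n\<close>.\<close>

definition adically_complete :: "'e::comm_ring_1 \<Rightarrow> bool" where
  "adically_complete p \<longleftrightarrow>
     (\<forall>s. (\<forall>n. p ^ n dvd s (Suc n) - s n) \<longrightarrow> (\<exists>l. \<forall>n. p ^ n dvd l - s n)) \<and>
     (\<forall>x. (\<forall>n. p ^ n dvd x) \<longrightarrow> x = 0)"

text \<open>Banach's fixed point principle for the \<open>p\<close>-adic metric.\<close>

lemma contraction_fixed_point:
  fixes p :: "'e::comm_ring_1"
  assumes complete: "adically_complete p"
    and contr: "\<And>n a b. p ^ n dvd a - b \<Longrightarrow> p ^ Suc n dvd T a - T b"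
  shows "\<exists>!a. T a = a"
proof (rule ex_ex1I)
  define s where "s n = (T ^^ n) 0" for n
  have "p ^ n dvd s (Suc n) - s n" for n
  proof (induction n)
    case (Suc n)
    thus ?case using contr[of n "s (Suc n)" "s n"] by (simp add: s_def)
  qed simp
  then obtain l where l: "\<And>n. p ^ n dvd l - s n"
    using complete unfolding adically_complete_def by blast
  have "p ^ n dvd T l - l" for n
  proof (cases n)
    case (Suc m)
    have "p ^ Suc m dvd T l - s (Suc m)"
      using contr[OF l[of m]] by (simp add: s_def)
    thus ?thesis
      using Suc dvd_diff[OF _ l[of "Suc m"], of "T l - s (Suc m)"] by simp
  qed simp
  hence "T l - l = 0"
    using complete unfolding adically_complete_def by blast
  thus "\<exists>a. T a = a" by auto
next
  fix a b assume ab: "T a = a" "T b = b"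
  have "p ^ n dvd a - b" for n
  proof (induction n)
    case (Suc n)
    from contr[OF Suc] ab show ?case by simp
  qed simp
  hence "a - b = 0"
    using complete unfolding adically_complete_def by blast
  thus "a = b" by simp
qed

lemma fps_X_power_dvd_iff:
  fixes f :: "'b::comm_ring_1 fps"
  shows "fps_X ^ n dvd f \<longleftrightarrow> (\<forall>i<n. f $ i = 0)"
proof
  assume "fps_X ^ n dvd f"
  thus "\<forall>i<n. f $ i = 0"
    by (auto simp: dvd_def fps_X_power_mult_nth)
next
  assume "\<forall>i<n. f $ i = 0"
  hence "f = fps_X ^ n * fps_shift n f"
    by (intro fps_ext) (simp add: fps_X_power_mult_nth)
  thus "fps_X ^ n dvd f" by (rule dvdI)
qed

lemma fps_const_dvd_iff:
  fixes f :: "'b::comm_ring_1 fps"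
  shows "fps_const c dvd f \<longleftrightarrow> (\<forall>k. c dvd f $ k)"
proof
  assume "fps_const c dvd f"
  thus "\<forall>k. c dvd f $ k" by (auto simp: dvd_def)
next
  assume "\<forall>k. c dvd f $ k"
  then obtain g where "\<And>k. f $ k = c * g k" unfolding dvd_def by metis
  hence "f = fps_const c * Abs_fps g" by (intro fps_ext) simp
  thus "fps_const c dvd f" by (rule dvdI)
qed

lemma adically_complete_fps_X: "adically_complete (fps_X :: 'b::comm_ring_1 fps)"
  unfolding adically_complete_def
proof (intro conjI allI impI)
  fix s :: "nat \<Rightarrow> 'b fps" assume s: "\<forall>n. fps_X ^ n dvd s (Suc n) - s n"
  have stable: "s (Suc i) $ i = s n $ i" if "i < n" for n i
    using that by (induction n) (use s in \<open>auto simp: fps_X_power_dvd_iff less_Suc_eq\<close>)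
  show "\<exists>l. \<forall>n. fps_X ^ n dvd l - s n"
    by (rule exI[of _ "Abs_fps (\<lambda>i. s (Suc i) $ i)"])
       (use stable in \<open>auto simp: fps_X_power_dvd_iff\<close>)
next
  fix x :: "'b fps" assume "\<forall>n. fps_X ^ n dvd x"
  hence "x $ i = 0" for i
    unfolding fps_X_power_dvd_iff by (metis lessI)
  thus "x = 0" by (intro fps_ext) simp
qed

lemma adically_complete_fps_const:
  fixes p :: "'b::comm_ring_1"
  assumes "adically_complete p"
  shows "adically_complete (fps_const p)"
  unfolding adically_complete_def
proof (intro conjI allI impI)
  fix s :: "nat \<Rightarrow> 'b fps" assume "\<forall>n. fps_const p ^ n dvd s (Suc n) - s n"
  hence "\<forall>k. \<exists>l. \<forall>n. p ^ n dvd l - s n $ k"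
    using assms unfolding adically_complete_def
    by (intro allI) (auto simp: fps_const_power fps_const_dvd_iff)
  then obtain l where "\<And>k n. p ^ n dvd l k - s n $ k" by metis
  thus "\<exists>l. \<forall>n. fps_const p ^ n dvd l - s n"
    by (intro exI[of _ "Abs_fps l"]) (simp add: fps_const_power fps_const_dvd_iff)
next
  fix x :: "'b fps" assume "\<forall>n. fps_const p ^ n dvd x"
  thus "x = 0"
    using assms unfolding adically_complete_def
    by (intro fps_ext) (simp add: fps_const_power fps_const_dvd_iff)
qed

lemma poly_diff_dvd: "(a - b :: 'e::comm_ring_1) dvd poly H a - poly H b"
proof (induction H)
  case (pCons c H)
  have "poly (pCons c H) a - poly (pCons c H) b =
      (a - b) * poly H a + b * (poly H a - poly H b)"
    by (simp add: algebra_simps)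
  thus ?case using pCons by (simp add: dvd_add dvd_mult)
qed simp

text \<open>The form of Hensel's lemma that is used: after division by the unit \<open>v\<close> the equation says
  that \<open>w\<close> is a fixed point of a \<open>p\<close>-adic contraction.\<close>

lemma hensel_unit:
  fixes v :: "'e::comm_ring_1"
  assumes "adically_complete p" "v dvd 1"
  shows "\<exists>w. g + v * w + p * poly H w = 0"
proof -
  from assms(2) obtain v' where v': "v * v' = 1" by (metis dvdE)
  define T where "T w = - (v' * (g + p * poly H w))" for w
  have "p ^ Suc n dvd T a - T b" if "p ^ n dvd a - b" for n a b
  proof -
    have "p ^ n dvd poly H b - poly H a"
      using dvd_trans[OF that poly_diff_dvd[of a b H]] dvd_minus_iff[of _ "poly H a - poly H b"]
      by simp
    hence "p * p ^ n dvd p * (poly H b - poly H a)" by (rule mult_dvd_mono[OF dvd_refl])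
    hence "p ^ Suc n dvd v' * (p * (poly H b - poly H a))" by simp
    also have "v' * (p * (poly H b - poly H a)) = T a - T b"
      by (simp add: T_def algebra_simps)
    finally show ?thesis .
  qed
  then obtain w where "T w = w"
    using contraction_fixed_point[OF assms(1), of T] by blast
  hence "v * w = v * T w" by (rule arg_cong[OF sym])
  also have "\<dots> = - (v * v' * (g + p * poly H w))"
    by (simp only: T_def mult_minus_right mult.assoc)
  also have "\<dots> = - (g + p * poly H w)" using v' by simp
  finally have "g + v * w + p * poly H w = 0" by simp
  thus ?thesis ..
qed

lemma fps_unit_iff:
  fixes f :: "'b::comm_ring_1 fps"
  shows "f dvd 1 \<longleftrightarrow> f $ 0 dvd 1"
proof
  assume "f dvd 1"
  then obtain g where "1 = f * g" by (rule dvdE)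
  hence "1 $ 0 = (f * g) $ 0" by simp
  hence "1 = f $ 0 * g $ 0" by simp
  thus "f $ 0 dvd 1" by (rule dvdI)
next
  assume "f $ 0 dvd 1"
  then obtain y where "1 = f $ 0 * y" by (rule dvdE)
  hence "1 = f * fps_right_inverse f y" by (intro fps_right_inverse[symmetric]) simp
  thus "f dvd 1" by (rule dvdI)
qed

lemma poly_taylor2:
  fixes q :: "'e::idom poly"
  shows "\<exists>H. \<forall>v. poly q (u + v) = poly q u + poly (pderiv q) u * v + v ^ 2 * poly H v"
proof (induction q)
  case 0
  show ?case by (intro exI[of _ 0]) simp
next
  case (pCons c q)
  then obtain H where H: "\<And>v. poly q (u + v) = poly q u + poly (pderiv q) u * v + v ^ 2 * poly H v"
    by blast
  show ?case
  proof (intro exI allI)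
    fix v
    have "poly (pCons c q) (u + v) =
        c + (u + v) * (poly q u + poly (pderiv q) u * v + v ^ 2 * poly H v)"
      by (simp only: poly_pCons H)
    also have "\<dots> = poly (pCons c q) u + poly (pderiv (pCons c q)) u * v +
        v ^ 2 * poly ([:poly (pderiv q) u:] + [:u, 1:] * H) v"
      by (simp add: pderiv_pCons algebra_simps power2_eq_square)
    finally show "poly (pCons c q) (u + v) = \<dots>" .
  qed
qed

section \<open>Algebraic elements of an extension of integral domains\<close>

locale domain_extension = subring_hom UNIV \<iota> for \<iota> :: "'d::idom \<Rightarrow> 'e::idom" +
  assumes embed_eq_0: "\<iota> x = 0 \<Longrightarrow> x = 0"
begin

lemma embed_eq_0_iff [simp]: "\<iota> x = 0 \<longleftrightarrow> x = 0"
  using embed_eq_0 by auto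

lemma degree_map_poly_embed [simp]: "degree (map_poly \<iota> R) = degree R"
  by (rule degree_map_poly) simp

lemma map_poly_embed_eq_0_iff [simp]: "map_poly \<iota> R = 0 \<longleftrightarrow> R = 0"
  by (rule map_poly_eq_0_iff) simp_all

definition is_algebraic :: "'e \<Rightarrow> bool" where
  "is_algebraic f \<longleftrightarrow> (\<exists>R. R \<noteq> 0 \<and> poly (map_poly \<iota> R) f = 0)"

text \<open>The elements of the linear span of \<open>V\<close> over the fraction field of the base that lie in the
  extension; denominators are cleared because both rings are only domains.\<close>

definition frac_span :: "'e set \<Rightarrow> 'e set" where
  "frac_span V = {x. \<exists>d c. d \<noteq> 0 \<and> \<iota> d * x = (\<Sum>v\<in>V. \<iota> (c v) * v)}"

lemma frac_span_add:
  assumes "x \<in> frac_span V" "y \<in> frac_span V"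
  shows "x + y \<in> frac_span V"
proof -
  from assms obtain d c d' c' where
    d: "d \<noteq> 0" "\<iota> d * x = (\<Sum>v\<in>V. \<iota> (c v) * v)" and
    d': "d' \<noteq> 0" "\<iota> d' * y = (\<Sum>v\<in>V. \<iota> (c' v) * v)"
    unfolding frac_span_def by blast
  have "\<iota> (d * d') * (x + y) = \<iota> d' * (\<iota> d * x) + \<iota> d * (\<iota> d' * y)"
    by (simp add: hom_mult algebra_simps)
  also have "\<dots> = (\<Sum>v\<in>V. \<iota> d' * (\<iota> (c v) * v) + \<iota> d * (\<iota> (c' v) * v))"
    by (simp only: d d' sum_distrib_left sum.distrib)
  also have "\<dots> = (\<Sum>v\<in>V. \<iota> (d' * c v + d * c' v) * v)"
    by (simp add: hom_add hom_mult algebra_simps)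
  finally show ?thesis
    using d d' unfolding frac_span_def
    by (intro CollectI exI[of _ "d * d'"] exI[of _ "\<lambda>v. d' * c v + d * c' v"]) simp
qed

lemma frac_span_scale:
  assumes "x \<in> frac_span V"
  shows "\<iota> a * x \<in> frac_span V"
proof -
  from assms obtain d c where d: "d \<noteq> 0" "\<iota> d * x = (\<Sum>v\<in>V. \<iota> (c v) * v)"
    unfolding frac_span_def by blast
  have "\<iota> d * (\<iota> a * x) = \<iota> a * (\<iota> d * x)" by (simp add: algebra_simps)
  also have "\<dots> = (\<Sum>v\<in>V. \<iota> (a * c v) * v)"
    by (simp only: d sum_distrib_left hom_mult UNIV_I mult.assoc)
  finally show ?thesis
    using d unfolding frac_span_def
    by (intro CollectI exI[of _ d] exI[of _ "\<lambda>v. a * c v"]) simp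
qed

lemma frac_span_uminus: "x \<in> frac_span V \<Longrightarrow> - x \<in> frac_span V"
  using frac_span_scale[of x V "- 1"] by (simp add: hom_uminus)

lemma frac_span_0: "0 \<in> frac_span V"
  unfolding frac_span_def by (intro CollectI exI[of _ 1] exI[of _ "\<lambda>_. 0"]) simp

lemma frac_span_sum: "(\<And>i. i \<in> I \<Longrightarrow> f i \<in> frac_span V) \<Longrightarrow> sum f I \<in> frac_span V"
  by (induction I rule: infinite_finite_induct) (simp_all add: frac_span_add frac_span_0)

lemma frac_span_base:
  assumes "finite V" "v \<in> V" shows "v \<in> frac_span V"
proof -
  have "(\<Sum>u\<in>V. \<iota> (if u = v then 1 else 0) * u) = (\<Sum>u\<in>V. if u = v then u else 0)"
    by (intro sum.cong) simp_all
  also have "\<dots> = v" using assms by simp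
  finally show ?thesis
    unfolding frac_span_def
    by (intro CollectI exI[of _ 1] exI[of _ "\<lambda>u. if u = v then 1 else 0"]) simp
qed

lemma frac_span_cancel:
  assumes "a \<noteq> 0" "\<iota> a * x \<in> frac_span V" shows "x \<in> frac_span V"
proof -
  from assms(2) obtain d c where "d \<noteq> 0" "\<iota> d * (\<iota> a * x) = (\<Sum>v\<in>V. \<iota> (c v) * v)"
    unfolding frac_span_def by blast
  thus ?thesis
    using assms(1) unfolding frac_span_def
    by (intro CollectI exI[of _ "d * a"] exI[of _ c]) (simp add: hom_mult mult.assoc)
qed

text \<open>Gaussian elimination without division: cross-multiplication with a fixed \<open>x\<^sub>j\<close> removes one
  spanning vector \<open>v\<close> from all other elements.\<close>

lemma frac_span_dependent:
  assumes "finite V" "finite I" "card V < card I" "\<And>i. i \<in> I \<Longrightarrow> x i \<in> frac_span V"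
  shows "\<exists>c. (\<exists>i\<in>I. c i \<noteq> 0) \<and> (\<Sum>i\<in>I. \<iota> (c i) * x i) = 0"
  using assms
proof (induction V arbitrary: I x rule: finite_induct)
  case empty
  have "x i = 0" if "i \<in> I" for i
    using empty.prems(3)[OF that] by (auto simp: frac_span_def)
  moreover from empty have "I \<noteq> {}" by auto
  ultimately show ?case by (intro exI[of _ "\<lambda>_. 1"]) auto
next
  case (insert v V)
  have "\<forall>i\<in>I. \<exists>d c. d \<noteq> 0 \<and> \<iota> d * x i = (\<Sum>u\<in>insert v V. \<iota> (c u) * u)"
    using insert.prems(3) unfolding frac_span_def by blast
  then obtain d c where d: "\<And>i. i \<in> I \<Longrightarrow> d i \<noteq> 0"
    and c: "\<And>i. i \<in> I \<Longrightarrow> \<iota> (d i) * x i = (\<Sum>u\<in>insert v V. \<iota> (c i u) * u)"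
    by metis
  have c': "\<iota> (d i) * x i = \<iota> (c i v) * v + (\<Sum>u\<in>V. \<iota> (c i u) * u)" if "i \<in> I" for i
    using insert.hyps c[OF that] by simp
  show ?case
  proof (cases "\<forall>i\<in>I. c i v = 0")
    case True
    have "x i \<in> frac_span V" if "i \<in> I" for i
      using c'[OF that] d[OF that] True that unfolding frac_span_def
      by (intro CollectI exI[of _ "d i"] exI[of _ "c i"]) simp
    thus ?thesis using insert.IH[of I x] insert.prems insert.hyps by simp
  next
    case False
    then obtain j where j: "j \<in> I" "c j v \<noteq> 0" by blast
    define x' where "x' i = \<iota> (c j v * d i) * x i - \<iota> (c i v * d j) * x j" for i
    have x': "x' i \<in> frac_span V" if "i \<in> I - {j}" for i
    proof -
      have "x' i = \<iota> (c j v) * (\<iota> (d i) * x i) - \<iota> (c i v) * (\<iota> (d j) * x j)"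
        by (simp add: x'_def hom_mult algebra_simps)
      also have "\<dots> = \<iota> (c j v) * (\<Sum>u\<in>V. \<iota> (c i u) * u) - \<iota> (c i v) * (\<Sum>u\<in>V. \<iota> (c j u) * u)"
        using that j by (simp add: c' right_diff_distrib distrib_left mult.left_commute)
      also have "\<dots> = (\<Sum>u\<in>V. \<iota> (c j v * c i u - c i v * c j u) * u)"
        by (simp add: sum_distrib_left sum_subtractf[symmetric] hom_minus hom_mult algebra_simps)
      finally show ?thesis
        unfolding frac_span_def
        by (intro CollectI exI[of _ 1] exI[of _ "\<lambda>u. c j v * c i u - c i v * c j u"]) simp
    qed
    have "card V < card (I - {j})"
      using insert.prems insert.hyps j by simp
    from insert.IH[of "I - {j}" x', OF _ this x'] insert.prems obtain e k where
      k: "k \<in> I - {j}" "e k \<noteq> 0" and e: "(\<Sum>i\<in>I - {j}. \<iota> (e i) * x' i) = 0" by blast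
    define C where "C i = (if i = j then - (\<Sum>i\<in>I - {j}. e i * (c i v * d j))
                           else e i * (c j v * d i))" for i
    have "(\<Sum>i\<in>I. \<iota> (C i) * x i) = \<iota> (C j) * x j + (\<Sum>i\<in>I - {j}. \<iota> (C i) * x i)"
      using j insert.prems by (simp add: sum.remove)
    also have "(\<Sum>i\<in>I - {j}. \<iota> (C i) * x i) = (\<Sum>i\<in>I - {j}. \<iota> (e i) * (\<iota> (c j v * d i) * x i))"
      by (intro sum.cong) (simp_all add: C_def hom_mult mult.assoc)
    also have "\<iota> (C j) * x j = - (\<Sum>i\<in>I - {j}. \<iota> (e i) * (\<iota> (c i v * d j) * x j))"
      by (simp add: C_def hom_uminus hom_sum hom_mult sum_distrib_right mult.assoc)
    also have "\<dots> + (\<Sum>i\<in>I - {j}. \<iota> (e i) * (\<iota> (c j v * d i) * x i)) =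
        (\<Sum>i\<in>I - {j}. \<iota> (e i) * x' i)"
      by (simp add: x'_def right_diff_distrib sum_subtractf)
    finally have "(\<Sum>i\<in>I. \<iota> (C i) * x i) = 0" using e by simp
    moreover have "C k \<noteq> 0" using k j d by (simp add: C_def)
    ultimately show ?thesis using k by blast
  qed
qed

text \<open>Algebraicity is tested on finite-dimensional spaces: an element is algebraic iff it lies in the
  stabiliser of some finite \<open>V\<close> containing \<open>1\<close>. Since stabilisers are rings, closure properties of
  algebraic elements become trivial once the elements involved share one \<open>V\<close>.\<close>

definition stabilizer :: "'e set \<Rightarrow> 'e set" where
  "stabilizer V = {f. \<forall>v\<in>V. f * v \<in> frac_span V}"

lemma stabilizerD:
  assumes "f \<in> stabilizer V" "x \<in> frac_span V"
  shows "f * x \<in> frac_span V"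
proof -
  from assms(2) obtain d c where d: "d \<noteq> 0" "\<iota> d * x = (\<Sum>v\<in>V. \<iota> (c v) * v)"
    unfolding frac_span_def by blast
  have "\<iota> d * (f * x) = f * (\<iota> d * x)" by (simp add: algebra_simps)
  also have "\<dots> = (\<Sum>v\<in>V. \<iota> (c v) * (f * v))"
    by (simp only: d sum_distrib_left mult.left_commute)
  also have "\<dots> \<in> frac_span V"
    using assms(1) by (intro frac_span_sum frac_span_scale) (simp add: stabilizer_def)
  finally show ?thesis by (rule frac_span_cancel[OF d(1)])
qed

lemma embed_in_stabilizer: "finite V \<Longrightarrow> \<iota> a \<in> stabilizer V"
  by (auto simp: stabilizer_def intro!: frac_span_scale frac_span_base)

lemma subring_stabilizer:
  assumes "finite V" shows "subring (stabilizer V)"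
proof
  show "1 \<in> stabilizer V"
    using assms by (auto simp: stabilizer_def frac_span_base)
  fix f g assume fg: "f \<in> stabilizer V" "g \<in> stabilizer V"
  have "(f - g) * v \<in> frac_span V" if "v \<in> V" for v
    using fg that frac_span_add[of "f * v" V "- (g * v)"] frac_span_uminus[of "g * v" V]
    by (simp add: stabilizer_def left_diff_distrib)
  thus "f - g \<in> stabilizer V" by (simp add: stabilizer_def)
  have "f * g * v \<in> frac_span V" if "v \<in> V" for v
    unfolding mult.assoc using fg(2) that by (intro stabilizerD[OF fg(1)]) (simp add: stabilizer_def)
  thus "f * g \<in> stabilizer V" by (simp add: stabilizer_def)
qed

text \<open>All powers of \<open>f\<close> lie in the span of \<open>V\<close>, so \<open>card V + 1\<close> of them satisfy a linear relation.\<close>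

lemma algebraic_if_stabilizer:
  assumes "finite V" "1 \<in> V" "f \<in> stabilizer V"
  shows "is_algebraic f"
proof -
  interpret stab: subring "stabilizer V"
    by (rule subring_stabilizer) fact
  interpret mp: subring_hom UNIV "map_poly \<iota>"
    using map_poly_hom by simp
  have "f ^ i \<in> frac_span V" for i
    using stab.power_mem[OF assms(3), of i] assms(2) by (auto simp: stabilizer_def)
  then obtain c k where k: "k \<le> card V" "c k \<noteq> 0" and c: "(\<Sum>i\<le>card V. \<iota> (c i) * f ^ i) = 0"
    using frac_span_dependent[of V "{..card V}" "\<lambda>i. f ^ i"] assms(1) by auto
  define R where "R = (\<Sum>i\<le>card V. monom (c i) i)"
  have "coeff R k = c k"
    using k by (simp add: R_def coeff_sum)
  hence "R \<noteq> 0" using k by auto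
  moreover have "poly (map_poly \<iota> R) f = 0"
    using c by (simp add: R_def mp.hom_sum map_poly_monom poly_sum poly_monom)
  ultimately show ?thesis by (auto simp: is_algebraic_def)
qed

text \<open>The span of the \<open>\<alpha>\<^sup>i v\<close> with \<open>i\<close> below the degree is closed under multiplication by \<open>\<alpha>\<close>,
  as the equation of \<open>\<alpha>\<close> rewrites the top power in terms of the lower ones.\<close>

lemma stabilizer_adjoin_root:
  assumes V: "finite V" "1 \<in> V"
    and Q: "poly Q \<alpha> = 0" "lead_coeff Q = \<iota> d" "d \<noteq> 0"
    and coeffs: "\<And>i. coeff Q i \<in> stabilizer V"
  shows "\<exists>W. finite W \<and> 1 \<in> W \<and> \<alpha> \<in> stabilizer W \<and> stabilizer V \<subseteq> stabilizer W"
proof -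
  define n where "n = degree Q"
  have "n > 0"
  proof (rule ccontr)
    assume "\<not> n > 0"
    then obtain c where "Q = [:c:]" unfolding n_def by (metis degree_0_id gr0I)
    thus False using Q by simp
  qed
  define W where "W = (\<lambda>(i, v). \<alpha> ^ i * v) ` ({..<n} \<times> V)"
  have "finite W" using V by (simp add: W_def)
  have one: "1 \<in> W" unfolding W_def using V \<open>n > 0\<close> by (intro image_eqI[of _ _ "(0, 1)"]) auto
  have *: "\<alpha> ^ i * x \<in> frac_span W" if x: "x \<in> frac_span V" and i: "i < n" for x i
  proof -
    from x obtain d c where d: "d \<noteq> 0" "\<iota> d * x = (\<Sum>v\<in>V. \<iota> (c v) * v)"
      unfolding frac_span_def by blast
    have "\<iota> d * (\<alpha> ^ i * x) = \<alpha> ^ i * (\<iota> d * x)" by (simp add: algebra_simps)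
    also have "\<dots> = (\<Sum>v\<in>V. \<iota> (c v) * (\<alpha> ^ i * v))"
      by (simp only: d sum_distrib_left mult.left_commute)
    also have "\<dots> \<in> frac_span W"
      using i by (intro frac_span_sum frac_span_scale frac_span_base \<open>finite W\<close>) (auto simp: W_def)
    finally show ?thesis by (rule frac_span_cancel[OF d(1)])
  qed
  have "f \<in> stabilizer W" if "f \<in> stabilizer V" for f
  proof -
    have "f * (\<alpha> ^ i * v) \<in> frac_span W" if "i < n" "v \<in> V" for i v
    proof -
      have "\<alpha> ^ i * (f * v) \<in> frac_span W"
        using \<open>f \<in> stabilizer V\<close> that by (intro *) (auto simp: stabilizer_def)
      thus ?thesis by (simp add: algebra_simps)
    qed
    thus ?thesis by (auto simp: stabilizer_def W_def)
  qed
  moreover have "\<alpha> \<in> stabilizer W"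
  proof -
    have "\<alpha> * (\<alpha> ^ i * v) \<in> frac_span W" if i: "i < n" and v: "v \<in> V" for i v
    proof (cases "Suc i < n")
      case True
      thus ?thesis
        using *[OF frac_span_base[OF V(1) v] True] by (simp add: mult.assoc)
    next
      case False
      hence n: "n = Suc i" using i by simp
      have "0 = poly Q \<alpha> * v" using Q by simp
      also have "poly Q \<alpha> = (\<Sum>j<n. coeff Q j * \<alpha> ^ j) + \<iota> d * \<alpha> ^ n"
        using Q unfolding poly_altdef n_def by (simp add: lessThan_Suc_atMost[symmetric])
      finally have "\<iota> d * (\<alpha> * (\<alpha> ^ i * v)) = - (\<Sum>j<n. \<alpha> ^ j * (coeff Q j * v))"
        unfolding n by (simp add: algebra_simps sum_distrib_left sum_distrib_right
            eq_neg_iff_add_eq_0 del: sum.lessThan_Suc)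
      also have "\<dots> \<in> frac_span W"
        using coeffs v by (intro frac_span_uminus frac_span_sum *) (auto simp: stabilizer_def)
      finally show ?thesis by (rule frac_span_cancel[OF Q(3)])
    qed
    thus ?thesis by (auto simp: stabilizer_def W_def)
  qed
  ultimately show ?thesis using \<open>finite W\<close> one by blast
qed

text \<open>Adjoin the elements one after another to \<open>V = {1}\<close>; enlarging \<open>V\<close> in this way only enlarges the
  stabiliser.\<close>

lemma ex_common_stabilizer:
  assumes "finite B" "\<And>b. b \<in> B \<Longrightarrow> is_algebraic b"
  shows "\<exists>V. finite V \<and> 1 \<in> V \<and> B \<subseteq> stabilizer V"
  using assms
proof (induction B rule: finite_induct)
  case empty
  show ?case by (intro exI[of _ "{1}"]) simp
next
  case (insert b B)
  then obtain V where V: "finite V" "1 \<in> V" "B \<subseteq> stabilizer V" by auto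
  from insert.prems obtain R where R: "R \<noteq> 0" "poly (map_poly \<iota> R) b = 0"
    unfolding is_algebraic_def by blast
  have "coeff (map_poly \<iota> R) i \<in> stabilizer V" for i
    using embed_in_stabilizer[OF V(1)] by (simp add: coeff_map_poly)
  moreover have "lead_coeff (map_poly \<iota> R) = \<iota> (lead_coeff R)"
    by (simp add: coeff_map_poly)
  ultimately obtain W where "finite W" "1 \<in> W" "b \<in> stabilizer W" "stabilizer V \<subseteq> stabilizer W"
    using stabilizer_adjoin_root[OF V(1,2) R(2), of "lead_coeff R"] R(1) by auto
  thus ?case using V by blast
qed

lemma algebraic_embed: "is_algebraic (\<iota> a)"
  unfolding is_algebraic_def
  by (intro exI[of _ "[:- a, 1:]"]) (simp add: map_poly_pCons hom_uminus)

lemma subring_algebraic: "subring {f. is_algebraic f}"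
proof
  show "1 \<in> {f. is_algebraic f}" using algebraic_embed[of 1] by simp
  fix f g assume "f \<in> {f. is_algebraic f}" "g \<in> {f. is_algebraic f}"
  then obtain V where V: "finite V" "1 \<in> V" "{f, g} \<subseteq> stabilizer V"
    using ex_common_stabilizer[of "{f, g}"] by auto
  interpret stab: subring "stabilizer V"
    by (rule subring_stabilizer) fact
  show "f - g \<in> {f. is_algebraic f}" "f * g \<in> {f. is_algebraic f}"
    using V algebraic_if_stabilizer[OF V(1,2)] by auto
qed

text \<open>A relation for \<open>b \<noteq> 0\<close> can be divided by \<open>b\<close> until its constant term \<open>d\<close> is nonzero, and then
  \<open>b\<close> divides \<open>d\<close>.\<close>

lemma algebraic_divides_base:
  assumes "is_algebraic b" "b \<noteq> 0"
  shows "\<exists>S d. d \<noteq> 0 \<and> \<iota> d = b * poly (map_poly \<iota> S) b"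
proof -
  have "poly (map_poly \<iota> R) b = 0 \<Longrightarrow> R \<noteq> 0 \<Longrightarrow> ?thesis" for R
  proof (induction R)
    case (pCons c R)
    have eq: "\<iota> c + b * poly (map_poly \<iota> R) b = 0"
      using pCons.prems by (simp add: map_poly_pCons)
    show ?case
    proof (cases "c = 0")
      case True
      thus ?thesis using eq pCons assms(2) by auto
    next
      case False
      interpret mp: subring_hom UNIV "map_poly \<iota>" using map_poly_hom by simp
      have "\<iota> c = b * poly (map_poly \<iota> (- R)) b"
        using eq by (simp add: mp.hom_uminus eq_neg_iff_add_eq_0)
      thus ?thesis using False by blast
    qed
  qed simp
  thus ?thesis using assms(1) unfolding is_algebraic_def by blast
qed

text \<open>Transitivity of algebraicity. The leading coefficient of \<open>Q\<close> divides an element of the base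
  with a cofactor that is again algebraic, and multiplying by this cofactor makes
  the preceding adjunction of a root applicable.\<close>

theorem algebraic_root:
  assumes "Q \<noteq> 0" "\<And>i. is_algebraic (coeff Q i)" "poly Q \<alpha> = 0"
  shows "is_algebraic \<alpha>"
proof -
  obtain V where V: "finite V" "1 \<in> V" and sub: "coeff Q ` {..degree Q} \<subseteq> stabilizer V"
    using ex_common_stabilizer[of "coeff Q ` {..degree Q}"] assms(2) by auto
  interpret stab: subring "stabilizer V"
    by (rule subring_stabilizer) fact
  have Q: "coeff Q i \<in> stabilizer V" for i
    using sub by (cases "i \<le> degree Q") (auto simp: coeff_eq_0)
  from assms(1) obtain S d where d: "d \<noteq> 0"
    and eq: "\<iota> d = lead_coeff Q * poly (map_poly \<iota> S) (lead_coeff Q)"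
    using algebraic_divides_base[OF assms(2)[of "degree Q"]] by auto
  define c where "c = poly (map_poly \<iota> S) (lead_coeff Q)"
  have "c \<noteq> 0" using d eq by (auto simp: c_def)
  have "c \<in> stabilizer V"
    unfolding c_def
    by (intro stab.poly_mem Q) (simp add: coeffs_in_def coeff_map_poly embed_in_stabilizer V)
  have "\<exists>W. finite W \<and> 1 \<in> W \<and> \<alpha> \<in> stabilizer W \<and> stabilizer V \<subseteq> stabilizer W"
  proof (rule stabilizer_adjoin_root[OF V _ _ d])
    show "poly (smult c Q) \<alpha> = 0" using assms(3) by simp
    show "lead_coeff (smult c Q) = \<iota> d" using eq by (simp add: c_def mult.commute)
    show "coeff (smult c Q) i \<in> stabilizer V" for i
      using \<open>c \<in> stabilizer V\<close> Q by simp
  qed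
  thus ?thesis using algebraic_if_stabilizer by blast
qed

end

lemma domain_extension_fps_of_poly:
  "domain_extension (fps_of_poly :: 'a::idom poly \<Rightarrow> 'a fps)"
  using subring_hom_fps_of_poly
  by (auto simp: domain_extension_def domain_extension_axioms_def fps_eq_iff poly_eq_iff)

lemma domain_extension_fps2_of_poly2:
  "domain_extension (fps2_of_poly2 :: 'a::idom poly poly \<Rightarrow> 'a fps fps)"
  using subring_hom_fps2_of_poly2
  by (auto simp: domain_extension_def domain_extension_axioms_def fps_eq_iff poly_eq_iff
      fps2_of_poly2_def coeff_map_poly)

interpretation fps1: domain_extension "fps_of_poly :: 'a::idom poly \<Rightarrow> 'a fps"
  by (rule domain_extension_fps_of_poly)

interpretation fps2: domain_extension "fps2_of_poly2 :: 'a::idom poly poly \<Rightarrow> 'a fps fps"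
  by (rule domain_extension_fps2_of_poly2)

lemma algebraic_fps_iff: "algebraic_fps f \<longleftrightarrow> fps1.is_algebraic f"
  by (simp add: algebraic_fps_def fps1.is_algebraic_def)

lemma algebraic_fps2_iff: "algebraic_fps2 f \<longleftrightarrow> fps2.is_algebraic f"
  by (simp add: algebraic_fps2_def fps2.is_algebraic_def)

section \<open>Specialisation of finitely generated subrings of \<open>K[[t]]\<close>\<close>

lemma newton_hensel:
  fixes q :: "'a::field fps poly"
  assumes "fps_X ^ (2 * e + c + 1) dvd poly q u"
    and "poly (pderiv q) u \<noteq> 0" "subdegree (poly (pderiv q) u) = e"
  shows "\<exists>u'. poly q u' = 0 \<and> fps_X ^ c dvd u' - u"
proof -
  from assms(1) obtain g where g: "poly q u = fps_X ^ (2 * e + c + 1) * g" by (rule dvdE)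
  define v where "v = fps_shift e (poly (pderiv q) u)"
  have v: "poly (pderiv q) u = fps_X ^ e * v"
    using subdegree_decompose[of "poly (pderiv q) u"] assms(3) by (simp add: v_def mult.commute)
  have "v $ 0 \<noteq> 0"
    using nth_subdegree_nonzero[OF assms(2)] assms(3) by (simp add: v_def)
  hence "v dvd 1" by (simp add: fps_unit_iff)
  obtain H where H: "\<And>w. poly q (u + w) = poly q u + poly (pderiv q) u * w + w ^ 2 * poly H w"
    using poly_taylor2 by blast
  \<comment> \<open>With \<open>u' = u + t\<^bsup>e+c+1\<^esup> w\<close>, the power \<open>t\<^bsup>2e+c+1\<^esup>\<close> divides every term of the Taylor expansion,
    and what remains has the unit \<open>v\<close> as its linear coefficient.\<close>
  define s :: "'a fps" where "s = fps_X ^ (e + c + 1)"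
  obtain w where w:
    "g + v * w + fps_X * poly (smult (fps_X ^ c) (monom 1 2 * pcompose H [:0, s:])) w = 0"
    using hensel_unit[OF adically_complete_fps_X \<open>v dvd 1\<close>] by blast
  have pow: "fps_X ^ (2 * e + c + 1) * fps_X ^ (c + 1) = s ^ 2"
    "fps_X ^ (2 * e + c + 1) = fps_X ^ e * s"
    by (simp_all add: s_def power_add[symmetric] power_mult[symmetric] del: power_Suc)
  have "poly q (u + s * w) =
      fps_X ^ e * s * g + fps_X ^ e * v * (s * w) + (s * w) ^ 2 * poly H (s * w)"
    by (simp only: H v g pow)
  also have "\<dots> = fps_X ^ e * s * g + fps_X ^ e * v * (s * w) +
      fps_X ^ (2 * e + c + 1) * fps_X ^ (c + 1) * (w ^ 2 * poly H (s * w))"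
    unfolding pow(1) by (simp add: power_mult_distrib mult.assoc)
  also have "\<dots> = fps_X ^ (2 * e + c + 1) * (g + v * w + fps_X ^ (c + 1) * (w ^ 2 * poly H (s * w)))"
    unfolding pow(2) by (simp add: algebra_simps)
  also have "g + v * w + fps_X ^ (c + 1) * (w ^ 2 * poly H (s * w)) = 0"
    using w by (simp add: poly_monom poly_pcompose mult_ac)
  finally have "poly q (u + s * w) = 0" by simp
  moreover have "fps_X ^ c dvd u + s * w - u"
    unfolding s_def by (simp add: power_add dvd_mult dvd_mult2)
  ultimately show ?thesis by blast
qed

text \<open>A map of this kind carries polynomial identities over \<open>K[t]\<close> between elements of \<open>A\<close> to identities
  between algebraic series close to the given ones.\<close>

definition specialization :: "'a::field_char_0 fps set \<Rightarrow> nat \<Rightarrow> ('a fps \<Rightarrow> 'a fps) \<Rightarrow> bool" where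
  "specialization A c \<phi> \<longleftrightarrow> subring_hom A \<phi> \<and> range fps_of_poly \<subseteq> A \<and>
     (\<forall>p. \<phi> (fps_of_poly p) = fps_of_poly p) \<and>
     (\<forall>a\<in>A. algebraic_fps (\<phi> a) \<and> fps_X ^ c dvd \<phi> a - a)"

lemma specialization_poly_cong:
  assumes "specialization A c \<phi>" "p \<in> coeffs_in A" "fps_X ^ c dvd x' - x"
  shows "fps_X ^ c dvd poly (map_poly \<phi> p) x' - poly p x"
proof -
  interpret subring_hom A \<phi> using assms(1) by (simp add: specialization_def)
  show ?thesis using assms(2)
  proof (induction p)
    case (pCons a p)
    have eq: "poly (map_poly \<phi> (pCons a p)) x' - poly (pCons a p) x =
        (\<phi> a - a) + (x' - x) * poly (map_poly \<phi> p) x' + x * (poly (map_poly \<phi> p) x' - poly p x)"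
      by (simp add: map_poly_pCons algebra_simps)
    have "fps_X ^ c dvd \<phi> a - a"
      using assms(1) pCons.prems by (simp add: specialization_def pCons_mem)
    moreover have "fps_X ^ c dvd poly (map_poly \<phi> p) x' - poly p x"
      using pCons by (simp add: pCons_mem)
    ultimately show ?case
      unfolding eq using assms(3) by (intro dvd_add dvd_mult dvd_mult2)
  qed simp
qed

lemma fps_cong_nth: "fps_X ^ c dvd f - g \<Longrightarrow> i < c \<Longrightarrow> f $ i = (g $ i :: 'a::comm_ring_1)"
  by (auto simp: fps_X_power_dvd_iff)

lemma specialization_mono:
  "specialization A c' \<phi> \<Longrightarrow> c \<le> c' \<Longrightarrow> specialization A c \<phi>"
  unfolding specialization_def by (meson dvd_trans le_imp_power_dvd)

text \<open>Pseudo-division by \<open>m\<close>: up to a factor that is a power of its leading coefficient, every relation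
  of \<open>u\<close> is a multiple of the minimal one. The leading coefficient survives \<open>\<phi>\<close> by assumption,
  so it can be cancelled after specialisation.\<close>

lemma specialization_vanishing:
  assumes \<phi>: "subring_hom A \<phi>"
    and m: "m \<in> coeffs_in A" "m \<noteq> 0" "\<phi> (lead_coeff m) \<noteq> 0"
    and minimal: "\<And>p. p \<in> coeffs_in A \<Longrightarrow> p \<noteq> 0 \<Longrightarrow> poly p u = 0 \<Longrightarrow> degree m \<le> degree p"
    and root: "poly m u = 0" "poly (map_poly \<phi> m) u' = 0"
    and p: "p \<in> coeffs_in A" "poly p u = 0"
  shows "poly (map_poly \<phi> p) u' = 0"
  using p
proof (induction "degree p" arbitrary: p rule: less_induct)
  case less
  interpret subring_hom A \<phi> by fact
  interpret P: subring_hom "coeffs_in A" "map_poly \<phi>" by (rule map_poly_hom)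
  show ?case
  proof (cases "p = 0")
    case False
    define a where "a = lead_coeff m"
    \<comment> \<open>One step of the division; the leading terms cancel.\<close>
    define r where "r = smult a p - monom (lead_coeff p) (degree p - degree m) * m"
    have le: "degree m \<le> degree p" using minimal False less.prems by blast
    have mem: "a \<in> A" "lead_coeff p \<in> A"
      using m less.prems by (simp_all add: a_def coeffs_inD)
    have mon: "monom (lead_coeff p) (degree p - degree m) \<in> coeffs_in A"
      using mem by (simp add: monom_mem)
    have r: "r \<in> coeffs_in A"
      unfolding r_def using mem mon m less.prems by (intro P.minus_mem P.mult_mem smult_mem)
    have root_r: "poly r u = 0" using root less.prems by (simp add: r_def)
    have "map_poly \<phi> r = smult (\<phi> a) (map_poly \<phi> p)
        - map_poly \<phi> (monom (lead_coeff p) (degree p - degree m)) * map_poly \<phi> m"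
      unfolding r_def using mem mon m less.prems
      by (simp add: P.hom_minus P.hom_mult map_poly_hom_smult smult_mem)
    hence "poly (map_poly \<phi> r) u' = \<phi> a * poly (map_poly \<phi> p) u'"
      using root by simp
    moreover have "poly (map_poly \<phi> r) u' = 0"
    proof (cases "r = 0")
      case False
      have "coeff r (degree p) = 0"
        using le by (simp add: r_def a_def coeff_monom_mult)
      moreover have "degree r \<le> degree p"
        unfolding r_def using le
        by (intro degree_diff_le degree_smult_le order_trans[OF degree_mult_le])
           (auto intro: order_trans[OF add_mono[OF degree_monom_le order_refl]])
      ultimately have "degree r < degree p"
        using False by (metis le_neq_implies_less leading_coeff_0_iff)
      thus ?thesis using less.hyps r root_r by blast
    qed simp
    ultimately show ?thesis using m by (simp add: a_def)
  qed simp
qed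

text \<open>If \<open>u\<close> is transcendental over \<open>A\<close> there is no relation to respect and a truncation of \<open>u\<close>
  serves as \<open>u'\<close>. Otherwise only the relation \<open>m\<close> of minimal degree matters. The series \<open>u\<close>
  almost solves the specialised equation, and Newton's method moves it to an exact solution.\<close>

lemma specialization_of_root:
  fixes u :: "'a::field_char_0 fps"
  assumes "\<And>c. \<exists>\<phi>. specialization A c \<phi>"
  shows "\<exists>\<phi> u'. specialization A c \<phi> \<and> algebraic_fps u' \<and> fps_X ^ c dvd u' - u \<and>
    (\<forall>p\<in>coeffs_in A. poly p u = 0 \<longrightarrow> poly (map_poly \<phi> p) u' = 0)"
proof (cases "\<exists>p\<in>coeffs_in A. p \<noteq> 0 \<and> poly p u = 0")
  case False
  from assms obtain \<phi> where \<phi>: "specialization A c \<phi>" by blast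
  define p where "p = poly_of_list (map (\<lambda>i. u $ i) [0..<c])"
  have "fps_X ^ c dvd fps_of_poly p - u"
    by (auto simp: fps_X_power_dvd_iff p_def nth_default_def)
  moreover have "algebraic_fps (fps_of_poly p)"
    by (simp add: algebraic_fps_iff fps1.algebraic_embed)
  ultimately show ?thesis using \<phi> False by (intro exI[of _ \<phi>] exI[of _ "fps_of_poly p"]) auto
next
  case True
  define N where "N p \<longleftrightarrow> p \<in> coeffs_in A \<and> p \<noteq> 0 \<and> poly p u = 0" for p
  from True have "\<exists>p. N p" by (auto simp: N_def)
  then obtain m where "N m" and minimal: "\<And>p. N p \<Longrightarrow> degree m \<le> degree p"
    using ex_has_least_nat[of N _ degree] by blast
  hence m: "m \<in> coeffs_in A" "m \<noteq> 0" "poly m u = 0" by (auto simp: N_def)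
  obtain \<phi>0 where "specialization A 0 \<phi>0" using assms by blast
  then interpret A: subring A by (simp add: specialization_def subring_hom_def)
  have "degree m \<noteq> 0"
  proof
    assume "degree m = 0"
    then obtain a where "m = [:a:]" by (metis degree_0_id)
    thus False using m by simp
  qed
  define d where "d = poly (pderiv m) u"
  \<comment> \<open>Characteristic zero makes the minimal equation separable.\<close>
  have "d \<noteq> 0"
  proof
    assume "d = 0"
    hence "N (pderiv m)"
      using m \<open>degree m \<noteq> 0\<close> by (auto simp: N_def A.pderiv_mem pderiv_eq_0_iff d_def)
    from minimal[OF this] show False using \<open>degree m \<noteq> 0\<close> by (simp add: degree_pderiv)
  qed
  define e where "e = subdegree d"
  define s where "s = subdegree (lead_coeff m)"
  \<comment> \<open>Precision enough to keep the derivative of order \<open>e\<close>, to start Newton's method, and to keep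
    the leading coefficient nonzero.\<close>
  define c' where "c' = 2 * e + c + 1 + s"
  from assms obtain \<phi> where \<phi>: "specialization A c' \<phi>" by blast
  then interpret subring_hom A \<phi> by (simp add: specialization_def)
  define q where "q = map_poly \<phi> m"
  have "fps_X ^ c' dvd poly q u"
    using specialization_poly_cong[OF \<phi> m(1), of u u] m by (simp add: q_def)
  hence q1: "fps_X ^ (2 * e + c + 1) dvd poly q u"
    by (rule power_le_dvd) (simp add: c'_def)
  have "fps_X ^ c' dvd poly (pderiv q) u - d"
    using specialization_poly_cong[OF \<phi> A.pderiv_mem[OF m(1)], of u u] m
    by (simp add: q_def d_def map_poly_pderiv)
  hence same: "poly (pderiv q) u $ i = d $ i" if "i \<le> e" for i
    by (rule fps_cong_nth) (use that in \<open>simp add: c'_def\<close>)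
  have "d $ e \<noteq> 0" unfolding e_def by (rule nth_subdegree_nonzero) fact
  hence nz: "poly (pderiv q) u $ e \<noteq> 0" using same[of e] by (metis order_refl)
  moreover have "poly (pderiv q) u $ i = 0" if "i < e" for i
    using same[of i] nth_less_subdegree_zero[of i d] that unfolding e_def by (metis less_imp_le)
  ultimately have q2: "subdegree (poly (pderiv q) u) = e" by (rule subdegreeI)
  have q3: "poly (pderiv q) u \<noteq> 0" using nz by auto
  from newton_hensel[OF q1 q3 q2] obtain u' where u': "poly q u' = 0" "fps_X ^ c dvd u' - u"
    by blast
  have "fps_X ^ c' dvd \<phi> (lead_coeff m) - lead_coeff m"
    using \<phi> m by (simp add: specialization_def coeffs_inD)
  hence "\<phi> (lead_coeff m) $ s = lead_coeff m $ s"
    by (rule fps_cong_nth) (simp add: c'_def)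
  also have "\<dots> \<noteq> 0" using m(2) unfolding s_def by (intro nth_subdegree_nonzero) simp
  finally have lead: "\<phi> (lead_coeff m) \<noteq> 0" by auto
  have "algebraic_fps u'"
    unfolding algebraic_fps_iff
  proof (rule fps1.algebraic_root[OF _ _ u'(1)])
    have "coeff q (degree m) \<noteq> 0" using lead by (simp add: q_def coeff_map_poly)
    thus "q \<noteq> 0" by auto
    show "fps1.is_algebraic (coeff q i)" for i
      using \<phi> coeffs_inD[OF m(1)]
      by (simp add: q_def coeff_map_poly specialization_def algebraic_fps_iff)
  qed
  moreover have "poly (map_poly \<phi> p) u' = 0" if "p \<in> coeffs_in A" "poly p u = 0" for p
    using specialization_vanishing[OF subring_hom_axioms m(1,2) lead _ m(3) _ that] minimal u'
    by (auto simp: N_def q_def)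
  moreover have "specialization A c \<phi>"
    using \<phi> by (rule specialization_mono) (simp add: c'_def)
  ultimately show ?thesis using u' by blast
qed

text \<open>The extension of \<open>\<phi>\<close> sends \<open>p(u)\<close> to \<open>(\<phi> p)(u')\<close>; respecting the relations of \<open>u\<close> makes
  this independent of the choice of \<open>p\<close>.\<close>

lemma specialization_adjoin:
  fixes u :: "'a::field_char_0 fps"
  assumes ex: "\<And>c. \<exists>\<phi>. specialization A c \<phi>"
  shows "\<exists>\<psi>. specialization ((\<lambda>p. poly p u) ` coeffs_in A) c \<psi>"
proof -
  obtain \<phi> u' where \<phi>: "specialization A c \<phi>" and u': "algebraic_fps u'" "fps_X ^ c dvd u' - u"
    and vanish: "\<And>p. p \<in> coeffs_in A \<Longrightarrow> poly p u = 0 \<Longrightarrow> poly (map_poly \<phi> p) u' = 0"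
    using specialization_of_root[OF ex, of c u] by blast
  interpret subring_hom A \<phi> using \<phi> by (simp add: specialization_def)
  interpret P: subring_hom "coeffs_in A" "map_poly \<phi>" by (rule map_poly_hom)
  interpret alg: subring "{f :: 'a fps. fps1.is_algebraic f}" by (rule fps1.subring_algebraic)
  define rep where "rep x = (SOME p. p \<in> coeffs_in A \<and> poly p u = x)" for x
  define \<psi> where "\<psi> x = poly (map_poly \<phi> (rep x)) u'" for x
  have \<psi>: "\<psi> (poly p u) = poly (map_poly \<phi> p) u'" if p: "p \<in> coeffs_in A" for p
  proof -
    have rep: "rep (poly p u) \<in> coeffs_in A \<and> poly (rep (poly p u)) u = poly p u"
      unfolding rep_def by (rule someI[of _ p]) (simp add: p)
    hence "poly (map_poly \<phi> (rep (poly p u) - p)) u' = 0"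
      using p by (intro vanish P.minus_mem) auto
    thus ?thesis using rep p by (simp add: \<psi>_def P.hom_minus)
  qed
  have const: "fps_of_poly r = poly [:fps_of_poly r:] u" "[:fps_of_poly r:] \<in> coeffs_in A" for r
    using \<phi> by (auto simp: specialization_def pCons_mem)
  have "specialization ((\<lambda>p. poly p u) ` coeffs_in A) c \<psi>"
    unfolding specialization_def
  proof (intro conjI ballI allI)
    show "subring_hom ((\<lambda>p. poly p u) ` coeffs_in A) \<psi>"
    proof
      show "1 \<in> (\<lambda>p. poly p u) ` coeffs_in A"
        by (rule image_eqI[of _ _ 1]) simp_all
      show "\<psi> 1 = 1" using \<psi>[of 1] by simp
      fix a b assume "a \<in> (\<lambda>p. poly p u) ` coeffs_in A" "b \<in> (\<lambda>p. poly p u) ` coeffs_in A"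
      then obtain p q where
        pq: "p \<in> coeffs_in A" "q \<in> coeffs_in A" "a = poly p u" "b = poly q u" by auto
      have eq: "a - b = poly (p - q) u" "a * b = poly (p * q) u" using pq by simp_all
      show "a - b \<in> (\<lambda>p. poly p u) ` coeffs_in A" "a * b \<in> (\<lambda>p. poly p u) ` coeffs_in A"
        unfolding eq by (intro imageI P.minus_mem P.mult_mem pq)+
      show "\<psi> (a - b) = \<psi> a - \<psi> b" "\<psi> (a * b) = \<psi> a * \<psi> b"
        using \<psi>[OF P.minus_mem[OF pq(1,2)]] \<psi>[OF P.mult_mem[OF pq(1,2)]] \<psi>[OF pq(1)] \<psi>[OF pq(2)]
        by (simp_all add: pq P.hom_minus P.hom_mult)
    qed
    show "range fps_of_poly \<subseteq> (\<lambda>p. poly p u) ` coeffs_in A"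
      using const by blast
    show "\<psi> (fps_of_poly r) = fps_of_poly r" for r
      using \<psi>[OF const(2), of r] \<phi> by (simp add: map_poly_pCons specialization_def)
    fix a assume "a \<in> (\<lambda>p. poly p u) ` coeffs_in A"
    then obtain p where p: "p \<in> coeffs_in A" "a = poly p u" by blast
    show "fps_X ^ c dvd \<psi> a - a"
      using specialization_poly_cong[OF \<phi> p(1) u'(2)] p by (simp add: \<psi>)
    have "poly (map_poly \<phi> p) u' \<in> {f. fps1.is_algebraic f}"
      using p u' \<phi> by (intro alg.poly_mem)
        (auto simp: coeffs_in_def coeff_map_poly specialization_def algebraic_fps_iff)
    thus "algebraic_fps (\<psi> a)" using p by (simp add: \<psi> algebraic_fps_iff)
  qed
  thus ?thesis by blast
qed

text \<open>Artin approximation for polynomial systems over \<open>K[t]\<close>, in terms of the ring generated by a formal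
  solution rather than the equations that it satisfies.\<close>

theorem ex_specialization:
  fixes S :: "'a::field_char_0 fps set"
  assumes "finite S"
  shows "\<exists>A. S \<subseteq> A \<and> (\<forall>c. \<exists>\<phi>. specialization A c \<phi>)"
  using assms
proof (induction S rule: finite_induct)
  case empty
  have "specialization (range fps_of_poly) c (\<lambda>f :: 'a fps. f)" for c
    unfolding specialization_def
  proof (intro conjI)
    show "subring_hom (range fps_of_poly) (\<lambda>f :: 'a fps. f)"
    proof
      show "1 \<in> range (fps_of_poly :: 'a poly \<Rightarrow> _)"
        by (rule image_eqI[of _ _ 1]) simp_all
    qed (auto simp: fps_of_poly_diff[symmetric] fps_of_poly_mult[symmetric])
  qed (auto simp: algebraic_fps_iff fps1.algebraic_embed)
  thus ?case by blast
next
  case (insert u S)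
  then obtain A where A: "S \<subseteq> A" "\<And>c. \<exists>\<phi>. specialization A c \<phi>" by blast
  then obtain \<phi> where "specialization A 0 \<phi>" by blast
  then interpret subring A by (simp add: specialization_def subring_hom_def)
  have "a \<in> (\<lambda>p. poly p u) ` coeffs_in A" if "a \<in> A" for a
    using that by (intro image_eqI[of _ _ "[:a:]"]) (simp_all add: pCons_mem)
  moreover have "u \<in> (\<lambda>p. poly p u) ` coeffs_in A"
    by (intro image_eqI[of _ _ "[:0, 1:]"]) (simp_all add: pCons_mem)
  ultimately show ?case
    using A specialization_adjoin[OF A(2)] by (intro exI[of _ "(\<lambda>p. poly p u) ` coeffs_in A"]) blast
qed

section \<open>Weierstrass division\<close>

definition x_regular :: "nat \<Rightarrow> 'a::field fps fps \<Rightarrow> bool" where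
  "x_regular d f \<longleftrightarrow> f $ d $ 0 \<noteq> 0 \<and> (\<forall>k<d. f $ k $ 0 = 0)"

lemma fps_X_dvd_iff: "fps_X dvd f \<longleftrightarrow> f $ 0 = (0 :: 'b::comm_ring_1)"
  using fps_X_power_dvd_iff[of 1 f] by simp

lemma fps2_unit_iff:
  fixes f :: "'a::field fps fps"
  shows "f dvd 1 \<longleftrightarrow> f $ 0 $ 0 \<noteq> 0"
  by (simp add: fps_unit_iff dvd_field_iff)

lemma fps_const_dvd_shift:
  "fps_const (c :: 'b::comm_ring_1) dvd f \<Longrightarrow> fps_const c dvd fps_shift d f"
  by (simp add: fps_const_dvd_iff)

lemma ex_poly_eq_fps:
  fixes f :: "'b::comm_ring_1 fps"
  assumes "fps_shift d f = 0"
  shows "\<exists>r. fps_of_poly r = f \<and> (\<forall>k\<ge>d. coeff r k = 0)"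
proof -
  have "f $ k = 0" if "k \<ge> d" for k
    using arg_cong[OF assms, of "\<lambda>g. g $ (k - d)"] that by simp
  thus ?thesis
    by (intro exI[of _ "poly_of_list (map (\<lambda>i. f $ i) [0..<d])"])
       (auto simp: fps_eq_iff nth_default_def)
qed

text \<open>Split \<open>f = \<alpha> + x\<^sup>d U\<close> with \<open>\<alpha>\<close> of \<open>x\<close>-degree below \<open>d\<close>, hence divisible by \<open>t\<close>, and \<open>U\<close> a unit.
  That \<open>g - q f\<close> has \<open>x\<close>-degree below \<open>d\<close> says that \<open>q U\<close> is a fixed point of a \<open>t\<close>-adic
  contraction; this yields existence and uniqueness of \<open>q\<close> at once.\<close>

lemma weierstrass_division_ex1:
  fixes f g :: "'a::field fps fps"
  assumes "x_regular d f"
  shows "\<exists>!q. fps_shift d (g - q * f) = 0"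
proof -
  define \<alpha> where "\<alpha> = fps_cutoff d f"
  define U where "U = fps_shift d f"
  have f: "f = \<alpha> + U * fps_X ^ d"
    by (intro fps_ext) (simp add: \<alpha>_def U_def fps_X_power_mult_right_nth)
  have "U dvd 1" using assms by (simp add: fps2_unit_iff U_def x_regular_def)
  then obtain V where UV: "U * V = 1" by (metis dvdE)
  have "fps_const fps_X dvd \<alpha>"
    using assms by (simp add: fps_const_dvd_iff fps_X_dvd_iff \<alpha>_def x_regular_def)
  define T where "T Z = fps_shift d g - fps_shift d (Z * V * \<alpha>)" for Z
  have fixed_point: "\<exists>!Z. T Z = Z"
  proof (rule contraction_fixed_point[OF adically_complete_fps_const[OF adically_complete_fps_X]])
    fix n and a b :: "'a fps fps" assume ab: "fps_const fps_X ^ n dvd a - b"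
    hence "fps_const fps_X * fps_const fps_X ^ n dvd \<alpha> * (a - b)"
      using \<open>fps_const fps_X dvd \<alpha>\<close> by (intro mult_dvd_mono)
    hence "fps_const fps_X ^ Suc n dvd \<alpha> * (a - b) * (- V)" by simp
    hence "fps_const fps_X ^ Suc n dvd fps_shift d (\<alpha> * (a - b) * (- V))"
      unfolding fps_const_power by (rule fps_const_dvd_shift)
    also have "\<alpha> * (a - b) * (- V) = b * V * \<alpha> - a * V * \<alpha>" by (simp add: algebra_simps)
    also have "fps_shift d \<dots> = T a - T b" by (simp add: T_def fps_shift_diff)
    finally show "fps_const fps_X ^ Suc n dvd T a - T b" .
  qed
  have iff: "fps_shift d (g - q * f) = 0 \<longleftrightarrow> T (q * U) = q * U" for q
  proof -
    have "g - q * f = g - q * U * V * \<alpha> - q * U * fps_X ^ d"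
      using UV by (simp add: f mult.assoc algebra_simps)
    hence "fps_shift d (g - q * f) = fps_shift d (g - q * U * V * \<alpha> - q * U * fps_X ^ d)"
      by (rule arg_cong)
    also have "\<dots> = T (q * U) - q * U"
      by (simp only: T_def fps_shift_diff fps_shift_times_fps_X_power')
    finally have "fps_shift d (g - q * f) = T (q * U) - q * U" .
    thus ?thesis by simp
  qed
  from fixed_point obtain Z where Z: "T Z = Z" "\<And>Z'. T Z' = Z' \<Longrightarrow> Z' = Z" by blast
  have VU: "Z * V * U = Z" using UV by (simp add: mult.assoc mult.commute)
  show ?thesis
  proof (rule ex1I[of _ "Z * V"])
    show "fps_shift d (g - Z * V * f) = 0" unfolding iff VU by (rule Z(1))
    fix q assume "fps_shift d (g - q * f) = 0"
    hence "q * U = Z" unfolding iff by (rule Z(2))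
    thus "q = Z * V" using UV by (auto simp: mult.assoc)
  qed
qed

text \<open>Weierstrass polynomials: monic in \<open>x\<close>, and a power of \<open>x\<close> modulo \<open>t\<close>. Reduction modulo \<open>t\<close> is a
  homomorphism, so in this form the notion is visibly multiplicative.\<close>

definition distinguished :: "'a::field fps poly \<Rightarrow> bool" where
  "distinguished a \<longleftrightarrow> lead_coeff a = 1 \<and> map_poly (\<lambda>f. f $ 0) a = monom 1 (degree a)"

lemma subring_hom_fps_nth_0: "subring_hom UNIV (\<lambda>f :: 'a::idom fps. f $ 0)"
  by standard simp_all

lemma distinguished_mult:
  assumes "distinguished a" "distinguished b"
  shows "distinguished (a * b)"
proof -
  interpret subring_hom UNIV "\<lambda>f :: 'a fps. f $ 0" by (rule subring_hom_fps_nth_0)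
  interpret P: subring_hom "coeffs_in UNIV" "map_poly (\<lambda>f :: 'a fps. f $ 0)"
    by (rule map_poly_hom)
  from assms have "a \<noteq> 0" "b \<noteq> 0" by (auto simp: distinguished_def)
  with assms show ?thesis
    using lead_coeff_mult[of a b]
    by (simp add: distinguished_def degree_mult_eq P.hom_mult mult_monom)
qed

lemma distinguished_x: "distinguished [:0, 1:]"
  by (simp add: distinguished_def map_poly_pCons monom_Suc)

lemma x_regular_distinguished:
  assumes "distinguished a" shows "x_regular (degree a) (fps_of_poly a)"
proof -
  have "coeff a k $ 0 = coeff (map_poly (\<lambda>f. f $ 0) a) k" for k
    by (simp add: coeff_map_poly)
  also have "\<dots> k = (if k = degree a then 1 else 0)" for k
    using assms by (simp add: distinguished_def)
  finally show ?thesis by (simp add: x_regular_def)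
qed

lemma weierstrass_division:
  fixes g :: "'a::field fps fps"
  assumes "x_regular d f"
  shows "\<exists>q r. g = q * f + fps_of_poly r \<and> (\<forall>k\<ge>d. coeff r k = 0)"
proof -
  obtain q where "fps_shift d (g - q * f) = 0"
    using weierstrass_division_ex1[OF assms] by blast
  from ex_poly_eq_fps[OF this] obtain r where
    "fps_of_poly r = g - q * f" and r: "\<forall>k\<ge>d. coeff r k = 0" by blast
  hence "g = q * f + fps_of_poly r" by simp
  with r show ?thesis by blast
qed

text \<open>Polynomial division by the monic \<open>b\<close> and Weierstrass division agree, by uniqueness.\<close>

lemma distinguished_cofactor:
  assumes b: "distinguished b" and eq: "fps_of_poly p = q * fps_of_poly b"
  shows "\<exists>s. q = fps_of_poly s \<and> p = b * s"
proof -
  have "b \<noteq> 0" using b by (auto simp: distinguished_def)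
  obtain s r where sr: "pseudo_divmod p b = (s, r)" by fastforce
  have p: "p = b * s + r" and r: "r = 0 \<or> degree r < degree b"
    using pseudo_divmod[OF \<open>b \<noteq> 0\<close> sr] b by (auto simp: distinguished_def)
  have "fps_shift (degree b) (fps_of_poly r) = 0"
    using r by (intro fps_ext) (auto simp: coeff_eq_0)
  moreover have "fps_of_poly r = 0 - (fps_of_poly s - q) * fps_of_poly b"
    using eq unfolding p by (simp add: fps_of_poly_add fps_of_poly_mult algebra_simps)
  ultimately have "fps_shift (degree b) (0 - (fps_of_poly s - q) * fps_of_poly b) = 0"
    by simp
  moreover have "fps_shift (degree b) (0 - 0 * fps_of_poly b) = 0" by simp
  ultimately have "fps_of_poly s - q = 0"
    using weierstrass_division_ex1[OF x_regular_distinguished[OF b], of 0] by blast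
  hence q: "q = fps_of_poly s" by simp
  have "fps_of_poly p = fps_of_poly (b * s)"
    by (simp add: eq q fps_of_poly_mult mult.commute)
  with q show ?thesis by (simp add: fps_of_poly_eq_iff)
qed

text \<open>Divide \<open>x\<^sup>d\<close> by \<open>f\<close>, where \<open>d\<close> is the \<open>x\<close>-order of \<open>f\<close> modulo \<open>t\<close>. Modulo \<open>t\<close> the power
  \<open>x\<^sup>d\<close> divides \<open>q f\<close>; so the remainder, of lower degree, vanishes modulo \<open>t\<close>, and comparing the
  coefficients of \<open>x\<^sup>d\<close> shows that \<open>q\<close> is a unit.\<close>

lemma weierstrass_preparation:
  fixes f :: "'a::field fps fps"
  assumes "\<not> fps_const fps_X dvd f"
  shows "\<exists>u a. u dvd 1 \<and> distinguished a \<and> f = u * fps_of_poly a"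
proof -
  from assms have ex: "\<exists>k. f $ k $ 0 \<noteq> 0"
    by (simp add: fps_const_dvd_iff fps_X_dvd_iff)
  define d where "d = (LEAST k. f $ k $ 0 \<noteq> 0)"
  have d: "f $ d $ 0 \<noteq> 0" "\<And>k. k < d \<Longrightarrow> f $ k $ 0 = 0"
    unfolding d_def using LeastI_ex[OF ex] not_less_Least by blast+
  hence reg: "x_regular d f" by (simp add: x_regular_def)
  obtain q r where eq: "fps_X ^ d = q * f + fps_of_poly r" and r: "\<And>k. k \<ge> d \<Longrightarrow> coeff r k = 0"
    using weierstrass_division[OF reg, of "fps_X ^ d"] by blast
  define a where "a = monom 1 d - r"
  have a: "fps_of_poly a = q * f"
    using eq by (simp add: a_def fps_of_poly_diff fps_of_poly_monom)
  have coeff_a: "coeff a k = (if k = d then 1 else - coeff r k)" for k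
    using r[of d] by (auto simp: a_def)
  have "coeff a k $ 0 = (\<Sum>i=0..k. q $ i $ 0 * f $ (k - i) $ 0)" for k
    using arg_cong[OF a, of "\<lambda>g. g $ k $ 0"] by (simp add: fps_mult_nth fps_sum_nth)
  also have "(\<Sum>i=0..k. q $ i $ 0 * f $ (k - i) $ 0) = (\<Sum>i\<in>{0..k} \<inter> {0}. q $ i $ 0 * f $ (k - i) $ 0)"
    if "k \<le> d" for k
    using that d(2) by (intro sum.mono_neutral_right) auto
  finally have a0: "coeff a k $ 0 = q $ 0 $ 0 * f $ k $ 0" if "k \<le> d" for k
    using that by simp
  from a0[of d] have "q $ 0 $ 0 \<noteq> 0" by (auto simp: coeff_a)
  hence "q dvd 1" by (simp add: fps2_unit_iff)
  then obtain u where u: "q * u = 1" by (metis dvdE)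
  have deg: "degree a = d"
    by (rule antisym[OF degree_le le_degree]) (auto simp: coeff_a r)
  have "coeff a k $ 0 = (if k = d then 1 else 0)" for k
    using a0[of k] d(2)[of k] r[of k] by (cases "k \<le> d") (auto simp: coeff_a)
  hence "distinguished a"
    unfolding distinguished_def deg by (intro conjI poly_eqI) (auto simp: coeff_a coeff_map_poly)
  moreover have "u dvd 1" using dvd_triv_right[of u q] u by simp
  moreover have "f = u * fps_of_poly a"
  proof -
    have "u * fps_of_poly a = (q * u) * f" unfolding a by (simp only: mult_ac)
    thus ?thesis using u by simp
  qed
  ultimately show ?thesis by blast
qed

section \<open>Reduction to polynomial identities over \<open>K[[t]]\<close>\<close>

definition subst_poly ::
    "'a::comm_ring_1 poly poly poly poly \<Rightarrow> 'a fps \<Rightarrow> 'a fps poly \<Rightarrow> 'a fps poly" where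
  "subst_poly P y z =
     poly (map_poly (\<lambda>Q. poly (map_poly (map_poly fps_of_poly) Q) [:y:]) P) z"

lemma subring_hom_subst_y:
  "subring_hom UNIV (\<lambda>Q. poly (map_poly fps2_of_poly2 Q) (fps_const (y :: 'a::idom fps)))"
  using fps2.eval_hom by simp

lemma fps_of_poly_subst_poly:
  fixes P :: "'a::idom poly poly poly poly"
  shows "fps_of_poly (subst_poly P y z) = subst_nested P y (fps_of_poly z)"
proof -
  have "fps_of_poly (poly (map_poly (map_poly fps_of_poly) Q) [:y:]) =
      poly (map_poly fps2_of_poly2 Q) (fps_const y)" for Q :: "'a poly poly poly"
    by (simp add: fps1.hom_poly map_poly_map_poly o_def fps2_of_poly2_def[symmetric, abs_def]
        fps_of_poly_const)
  thus ?thesis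
    by (simp add: subst_poly_def subst_nested_def fps1.hom_poly map_poly_map_poly o_def)
qed

lemma subst_poly_specialization:
  assumes \<phi>: "specialization A c \<phi>" and y: "y \<in> A" and z: "z \<in> coeffs_in A"
  shows "map_poly \<phi> (subst_poly P y z) = subst_poly P (\<phi> y) (map_poly \<phi> z)"
proof -
  interpret subring_hom A \<phi> using \<phi> by (simp add: specialization_def)
  interpret P: subring_hom "coeffs_in A" "map_poly \<phi>" by (rule map_poly_hom)
  have mem: "map_poly fps_of_poly q \<in> coeffs_in A" for q
    using \<phi> by (auto simp: coeffs_in_def coeff_map_poly specialization_def)
  have const: "map_poly \<phi> (map_poly fps_of_poly q) = map_poly fps_of_poly q" for q
    using \<phi> by (simp add: map_poly_map_poly o_def specialization_def)
  define ev where "ev Q = poly (map_poly (map_poly fps_of_poly) Q) [:y:]" for Q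
  have Q: "map_poly (map_poly fps_of_poly) Q \<in> coeffs_in (coeffs_in A)" for Q
    by (simp add: coeffs_in_def[of "coeffs_in A"] coeff_map_poly mem)
  have ev: "ev Q \<in> coeffs_in A"
    "map_poly \<phi> (ev Q) = poly (map_poly (map_poly fps_of_poly) Q) [:\<phi> y:]" for Q
    unfolding ev_def using y
    by (simp_all add: P.poly_mem P.hom_poly Q pCons_mem map_poly_map_poly o_def const map_poly_pCons)
  have "map_poly ev P \<in> coeffs_in (coeffs_in A)"
    using ev(1) by (simp add: coeffs_in_def[of "coeffs_in A"] coeff_map_poly ev_def)
  moreover have "ev 0 = 0" by (simp add: ev_def)
  ultimately have "map_poly \<phi> (poly (map_poly ev P) z) = 
      poly (map_poly (\<lambda>Q. poly (map_poly (map_poly fps_of_poly) Q) [:\<phi> y:]) P) (map_poly \<phi> z)"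
    using z by (simp add: P.hom_poly map_poly_map_poly o_def ev(2))
  thus ?thesis by (simp add: subst_poly_def ev_def[abs_def])
qed

lemma subst_nested_pderiv:
  fixes P :: "'a::idom poly poly poly poly"
  shows "subst_nested (pderiv P) y z =
    poly (pderiv (map_poly (\<lambda>Q. poly (map_poly fps2_of_poly2 Q) (fps_const y)) P)) z"
proof -
  interpret subring_hom UNIV "\<lambda>Q. poly (map_poly fps2_of_poly2 Q) (fps_const y)"
    by (rule subring_hom_subst_y)
  show ?thesis by (simp add: subst_nested_def map_poly_pderiv)
qed

lemma subst_nested_taylor:
  fixes P :: "'a::idom poly poly poly poly"
  shows "\<exists>H. \<forall>v. subst_nested P y (z + v) =
    subst_nested P y z + subst_nested (pderiv P) y z * v + v ^ 2 * poly H v"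
  unfolding subst_nested_pderiv unfolding subst_nested_def by (rule poly_taylor2)

lemma subst_nested_diff_dvd:
  fixes P :: "'a::idom poly poly poly poly"
  shows "z - z' dvd subst_nested P y z - subst_nested P y z'"
  unfolding subst_nested_def by (rule poly_diff_dvd)

text \<open>A certificate for solvability near \<open>z\<close> with finitely many coefficients in \<open>K[[t]]\<close>. The square of
  \<open>a\<close> matches the quadratic error term of Newton's method, and the extra factor \<open>x\<close> makes the
  correction topologically small.\<close>

definition tougeron_data ::
    "'a::field poly poly poly poly \<Rightarrow> 'a fps \<Rightarrow> 'a fps poly \<Rightarrow> 'a fps poly \<Rightarrow> 'a fps poly \<Rightarrow>
      'a fps poly \<Rightarrow> bool" where
  "tougeron_data P y z a G V \<longleftrightarrow>
     subst_poly P y z = [:0, 1:] * a ^ 2 * G \<and> subst_poly (pderiv P) y z = a * V \<and>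
     a \<noteq> 0 \<and> coeff V 0 $ 0 \<noteq> 0"

text \<open>Passing from \<open>z\<close> to its remainder changes it by a multiple of \<open>x a\<^sup>2\<close>. By Taylor expansion this
  changes \<open>P\<close> by a multiple of \<open>x a\<^sup>2\<close> as well, and changes the derivative, a unit times
  \<open>a\<close>, by a multiple of \<open>x a\<^sup>2\<close>, which alters only the unit and keeps its value at the origin.\<close>

lemma ex_tougeron_data:
  fixes P :: "'a::field poly poly poly poly"
  assumes sol: "nested_solution P y z"
    and deriv: "\<not> fps_const fps_X dvd subst_nested (pderiv P) y z"
  shows "\<exists>z0 a G V. tougeron_data P y z0 a G V \<and> lead_coeff a = 1"
proof -
  obtain u a where u: "u dvd 1" and a: "distinguished a"
    and \<delta>: "subst_nested (pderiv P) y z = u * fps_of_poly a"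
    using weierstrass_preparation[OF deriv] by blast
  define b where "b = [:0, 1:] * a ^ 2"
  define A where "A = fps_of_poly a"
  have b: "distinguished b"
    unfolding b_def power2_eq_square by (intro distinguished_mult distinguished_x a)
  have B: "fps_of_poly b = fps_X * A ^ 2"
    by (simp only: b_def A_def fps_of_poly_mult fps_of_poly_power fps_of_poly_fps_X)
  obtain h z0 where z: "z = h * fps_of_poly b + fps_of_poly z0"
    using weierstrass_division[OF x_regular_distinguished[OF b], of z] by blast
  define v where "v = - (h * fps_X * A ^ 2)"
  have z0: "fps_of_poly z0 = z + v" by (simp add: z B v_def)
  obtain H where H: "\<And>v. subst_nested P y (z + v) =
      subst_nested P y z + subst_nested (pderiv P) y z * v + v ^ 2 * poly H v"
    using subst_nested_taylor[of P y z] by blast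
  have "fps_of_poly (subst_poly P y z0) = u * A * v + v ^ 2 * poly H v"
    using sol by (simp add: fps_of_poly_subst_poly z0 H \<delta> A_def nested_solution_def)
  also have "\<dots> = (h ^ 2 * fps_X * A ^ 2 * poly H v - u * h * A) * fps_of_poly b"
    by (simp add: B v_def algebra_simps power2_eq_square)
  finally obtain G where G: "subst_poly P y z0 = b * G"
    using distinguished_cofactor[OF b] by blast
  have "v dvd subst_nested (pderiv P) y (z + v) - subst_nested (pderiv P) y z"
    using subst_nested_diff_dvd[of "z + v" z "pderiv P" y] by simp
  then obtain k where k: "subst_nested (pderiv P) y (z + v) = subst_nested (pderiv P) y z + v * k"
    by (metis dvdE diff_add_cancel add.commute)
  have "fps_of_poly (subst_poly (pderiv P) y z0) = (u - fps_X * (h * A * k)) * fps_of_poly a"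
    unfolding fps_of_poly_subst_poly z0 k \<delta>
    by (simp add: v_def A_def algebra_simps power2_eq_square)
  then obtain V where V: "u - fps_X * (h * A * k) = fps_of_poly V" "subst_poly (pderiv P) y z0 = a * V"
    using distinguished_cofactor[OF a] by blast
  have "coeff V 0 $ 0 = u $ 0 $ 0"
    using arg_cong[OF V(1), of "\<lambda>g. g $ 0 $ 0"] by simp
  hence "coeff V 0 $ 0 \<noteq> 0" using u by (simp add: fps2_unit_iff)
  moreover have "lead_coeff a = 1" "a \<noteq> 0" using a by (auto simp: distinguished_def)
  ultimately have "tougeron_data P y z0 a G V"
    using G V(2) by (simp add: tougeron_data_def b_def)
  thus ?thesis using \<open>lead_coeff a = 1\<close> by blast
qed

text \<open>Agreement modulo \<open>t\<close> keeps \<open>V(0,0)\<close>, and monicity keeps \<open>a \<noteq> 0\<close>.\<close>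

lemma tougeron_data_specialization:
  assumes \<phi>: "specialization A 1 \<phi>"
    and data: "tougeron_data P y z a G V" and a: "lead_coeff a = 1"
    and mem: "y \<in> A" "z \<in> coeffs_in A" "a \<in> coeffs_in A" "G \<in> coeffs_in A" "V \<in> coeffs_in A"
  shows "tougeron_data P (\<phi> y) (map_poly \<phi> z) (map_poly \<phi> a) (map_poly \<phi> G) (map_poly \<phi> V)"
proof -
  interpret subring_hom A \<phi> using \<phi> by (simp add: specialization_def)
  interpret P: subring_hom "coeffs_in A" "map_poly \<phi>" by (rule map_poly_hom)
  have x: "[:0, 1:] \<in> coeffs_in A" "map_poly \<phi> [:0, 1:] = [:0, 1:]"
    by (simp_all add: pCons_mem map_poly_pCons)
  have "subst_poly P (\<phi> y) (map_poly \<phi> z) = map_poly \<phi> ([:0, 1:] * a ^ 2 * G)"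
    using data by (simp add: subst_poly_specialization[OF \<phi> mem(1,2), symmetric] tougeron_data_def)
  also have "\<dots> = [:0, 1:] * map_poly \<phi> a ^ 2 * map_poly \<phi> G"
    by (simp only: P.hom_mult P.hom_power P.mult_mem P.power_mem x mem)
  finally have 1: "subst_poly P (\<phi> y) (map_poly \<phi> z) = [:0, 1:] * map_poly \<phi> a ^ 2 * map_poly \<phi> G" .
  have 2: "subst_poly (pderiv P) (\<phi> y) (map_poly \<phi> z) = map_poly \<phi> a * map_poly \<phi> V"
    using data mem
    by (simp add: subst_poly_specialization[OF \<phi> mem(1,2), symmetric] tougeron_data_def P.hom_mult)
  have "coeff (map_poly \<phi> a) (degree a) = 1"
    using a by (simp add: coeff_map_poly)
  hence 3: "map_poly \<phi> a \<noteq> 0" by auto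
  have "fps_X ^ 1 dvd \<phi> (coeff V 0) - coeff V 0"
    using \<phi> coeffs_inD[OF mem(5)] by (simp add: specialization_def)
  hence "\<phi> (coeff V 0) $ 0 = coeff V 0 $ 0" by (rule fps_cong_nth) simp
  thus ?thesis
    using 1 2 3 data by (simp add: tougeron_data_def coeff_map_poly)
qed

text \<open>With \<open>z = z\<^sub>0 + a x w\<close> every term of the Taylor expansion is divisible by \<open>x a\<^sup>2\<close>. The cofactor is
  \<open>G + V w + x (\<dots>)\<close>, to which Hensel's lemma applies since \<open>V\<close> is a unit.\<close>

lemma nested_solution_of_tougeron_data:
  fixes P :: "'a::field poly poly poly poly"
  assumes "tougeron_data P y z0 a G V"
  shows "\<exists>z. nested_solution P y z"
proof -
  define A where "A = fps_of_poly a"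
  have P0: "subst_nested P y (fps_of_poly z0) = fps_X * A ^ 2 * fps_of_poly G"
    using assms by (simp only: fps_of_poly_subst_poly[symmetric] tougeron_data_def A_def
        fps_of_poly_mult fps_of_poly_power fps_of_poly_fps_X)
  have P1: "subst_nested (pderiv P) y (fps_of_poly z0) = A * fps_of_poly V"
    using assms by (simp only: fps_of_poly_subst_poly[symmetric] tougeron_data_def A_def
        fps_of_poly_mult)
  obtain H where H: "\<And>v. subst_nested P y (fps_of_poly z0 + v) =
      subst_nested P y (fps_of_poly z0) + subst_nested (pderiv P) y (fps_of_poly z0) * v + v ^ 2 * poly H v"
    using subst_nested_taylor[of P y "fps_of_poly z0"] by blast
  have "fps_of_poly V dvd 1"
    using assms by (simp add: fps2_unit_iff tougeron_data_def)
  then obtain w where w: "fps_of_poly G + fps_of_poly V * w +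
      fps_X * poly (monom 1 2 * pcompose H [:0, A * fps_X:]) w = 0"
    using hensel_unit[OF adically_complete_fps_X] by blast
  have "subst_nested P y (fps_of_poly z0 + A * fps_X * w) =
      fps_X * A ^ 2 * (fps_of_poly G + fps_of_poly V * w + fps_X * (w ^ 2 * poly H (A * fps_X * w)))"
    unfolding H P0 P1 by (simp add: algebra_simps power2_eq_square)
  also have "fps_of_poly G + fps_of_poly V * w + fps_X * (w ^ 2 * poly H (A * fps_X * w)) = 0"
    using w by (simp add: poly_monom poly_pcompose mult_ac)
  finally show ?thesis unfolding nested_solution_def by auto
qed

section \<open>Algebraicity of the second component\<close>

lemma algebraic_fps_const:
  fixes y :: "'a::idom fps"
  assumes "algebraic_fps y"
  shows "algebraic_fps2 (fps_const y)"
proof -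
  from assms obtain R where R: "R \<noteq> 0" "poly (map_poly fps_of_poly R) y = 0"
    unfolding algebraic_fps_def by blast
  interpret c: subring_hom UNIV "fps_const :: 'a fps \<Rightarrow> _" by (rule subring_hom_fps_const)
  have emb: "fps2_of_poly2 [:p:] = fps_const (fps_of_poly p)" for p :: "'a poly"
    by (simp add: fps2_of_poly2_def map_poly_pCons fps_of_poly_const)
  have "map_poly fps2_of_poly2 (map_poly (\<lambda>p. [:p:]) R) = map_poly fps_const (map_poly fps_of_poly R)"
    by (simp add: map_poly_map_poly o_def emb)
  hence "poly (map_poly fps2_of_poly2 (map_poly (\<lambda>p. [:p:]) R)) (fps_const y) = 0"
    using c.hom_poly[of "map_poly fps_of_poly R" y] R by simp
  moreover have "map_poly (\<lambda>p. [:p:]) R \<noteq> 0"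
    using R by (simp add: map_poly_eq_0_iff)
  ultimately show ?thesis unfolding algebraic_fps2_def by blast
qed

text \<open>The polynomial \<open>P(t,x,y,Z)\<close> in \<open>Z\<close> has algebraic coefficients, and it is nonzero because its
  derivative has a nonzero value somewhere.\<close>

lemma algebraic_fps2_of_nested_solution:
  fixes P :: "'a::field poly poly poly poly"
  assumes y: "algebraic_fps y" and z: "nested_solution P y z"
    and nz: "subst_nested (pderiv P) y z0 \<noteq> 0"
  shows "algebraic_fps2 z"
proof -
  define F where "F = map_poly (\<lambda>Q. poly (map_poly fps2_of_poly2 Q) (fps_const y)) P"
  interpret alg: subring "{f :: 'a fps fps. fps2.is_algebraic f}" by (rule fps2.subring_algebraic)
  have "poly (pderiv F) z0 \<noteq> 0"
    using nz by (simp add: subst_nested_pderiv F_def)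
  hence nonzero: "F \<noteq> 0" by auto
  have root: "poly F z = 0"
    using z by (simp add: nested_solution_def subst_nested_def F_def)
  have coeffs: "fps2.is_algebraic (coeff F i)" for i
  proof -
    have "poly (map_poly fps2_of_poly2 (coeff P i)) (fps_const y) \<in> {f. fps2.is_algebraic f}"
      using algebraic_fps_const[OF y]
      by (intro alg.poly_mem)
         (simp_all add: coeffs_in_def coeff_map_poly fps2.algebraic_embed algebraic_fps2_iff)
    thus ?thesis by (simp add: F_def coeff_map_poly)
  qed
  show ?thesis
    unfolding algebraic_fps2_iff by (rule fps2.algebraic_root[OF nonzero coeffs root])
qed

theorem theorem1p1:
  fixes P :: "'a::field_char_0 poly poly poly poly"
    and yhat :: "'a fps" and zhat :: "'a fps fps"
  assumes "nested_solution P yhat zhat"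
    and "\<not> fps_const fps_X dvd subst_nested (pderiv P) yhat zhat"
  shows "(\<exists>y z. algebraic_fps y \<and> algebraic_fps2 z \<and> nested_solution P y z) \<and>
    ((\<forall>y z. nested_solution P y z \<longrightarrow> y = yhat \<and> z = zhat) \<longrightarrow>
      algebraic_fps yhat \<and> algebraic_fps2 zhat)"
proof -
  obtain z0 a G V where data: "tougeron_data P yhat z0 a G V" and a: "lead_coeff a = 1"
    using ex_tougeron_data[OF assms] by blast
  obtain A where A: "insert yhat (set (coeffs z0) \<union> set (coeffs a) \<union> set (coeffs G) \<union> set (coeffs V)) \<subseteq> A"
    and ex: "\<And>c. \<exists>\<phi>. specialization A c \<phi>"
    using ex_specialization[of "insert yhat (set (coeffs z0) \<union> set (coeffs a) \<union> set (coeffs G) \<union> set (coeffs V))"]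
    by auto
  obtain \<phi> where \<phi>: "specialization A 1 \<phi>" using ex by blast
  then interpret subring_hom A \<phi> by (simp add: specialization_def)
  have mem: "p \<in> coeffs_in A" if "set (coeffs p) \<subseteq> A" for p
    using that by (auto simp: coeffs_in_def) (metis coeff_in_coeffs coeff_eq_0 in_mono linorder_not_less zero_mem coeff_0)
  define y where "y = \<phi> yhat"
  have data': "tougeron_data P y (map_poly \<phi> z0) (map_poly \<phi> a) (map_poly \<phi> G) (map_poly \<phi> V)"
    unfolding y_def using A by (intro tougeron_data_specialization[OF \<phi> data a] mem) auto
  obtain z where z: "nested_solution P y z"
    using nested_solution_of_tougeron_data[OF data'] by blast
  have y: "algebraic_fps y"
    using \<phi> A by (simp add: specialization_def y_def)
  have "subst_poly (pderiv P) y (map_poly \<phi> z0) \<noteq> 0"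
    using data' by (auto simp: tougeron_data_def)
  hence "subst_nested (pderiv P) y (fps_of_poly (map_poly \<phi> z0)) \<noteq> 0"
    by (metis fps_of_poly_0 fps_of_poly_eq_iff fps_of_poly_subst_poly)
  hence "algebraic_fps2 z"
    by (rule algebraic_fps2_of_nested_solution[OF y z])
  with y z show ?thesis by blast
qed

end
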